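(* Let $\tilde\pi$ be the matching obtained by directly aligning the noisy vertex features, as defined in the context. (i) For any $K>4$, if $\sigma^2\ge 2s\bigl(1+\frac Kn\bigr)^{-2}$, then $$\mathbb P(\tilde\pi=\pi^* )\le e^{-\frac{K-4}{4}}.$$ Hence if $\sigma^2\gg s$ (as $n\to\infty$, with $d,s,\sigma$ possibly depending on $n$), the probability of perfect recovery $\mathbb P(\tilde\pi=\pi^* )$ converges to $0$. (ii) If instead (with $d,s,\sigma$ possibly depending on $n$) $\frac14\sigma^2\le s\le\frac d2$ and $\sigma^2\gg\frac{s}{\sqrt{d\log n}}$ as $n\to\infty$, then $$\lim_{n\to\infty}\mathbb P(\tilde\pi=\pi^* )=0.$$
   Context: Notation: $[n]=\{1,\dots,n\}$; $a_n\gg b_n$ means $b_n/a_n\to0$. Features: for $i\in[n]$, $x_i\in\{0,1\}^d$ has entries $x_i(k)$, all independent Bernoulli$(s/d)$ with $0<s\le d$. Let $\pi^*$ be a permutation of $[n]$. One observes $y_i=x_i+\varepsilon_i$ and $y'_{\pi^*(i)}=x_i+\varepsilon'_{\pi^*(i)}$ for $i\in[n]$, where all $\varepsilon_i,\varepsilon_i'$ are independent $\mathcal N(0,\sigma^2I_d)$ vectors, independent of the $x_i$, with $\sigma>0$. Linear matching: $\tilde\pi=\arg\min_\pi\sum_{i=1}^n\|y_i-y'_{\pi(i)}\|^2$ over all permutations $\pi$ of $[n]$ (almost surely unique).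
   Formalization: The bound in (i) fails as printed (n=1, d=s=σ=1, K=8: the probability is 1). Instead it is proved as printed when 3K ≤ n, and with (1−K/n)^{-2} in place of (1+K/n)^{-2} for all 4 < K < n. The limit in (i) and part (ii) are unchanged. *)

theory Defs
  imports "HOL-Probability.Probability"
begin

text \<open>
  Vectors of \<open>\<real>\<^sup>d\<close> are functions \<open>nat \<Rightarrow> real\<close> of which only the values on
  \<open>{1..d}\<close> matter (the dimension varies with \<open>n\<close> in the limit statements), and
  \<^const>\<open>L2_set\<close> is the Euclidean norm.
\<close>

definition matching_cost ::
  "nat \<Rightarrow> nat \<Rightarrow> (nat \<Rightarrow> nat \<Rightarrow> real) \<Rightarrow> (nat \<Rightarrow> nat \<Rightarrow> real) \<Rightarrow> (nat \<Rightarrow> nat) \<Rightarrow> real"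
where
  "matching_cost n d Y Y' \<pi> = (\<Sum>i=1..n. (L2_set (\<lambda>k. Y i k - Y' (\<pi> i) k) {1..d})\<^sup>2)"

text \<open>
  In case of ties (a null event in the model below), \<open>ARG_MIN\<close> selects one of the minimizers,
  depending only on the set of all minimizers.
\<close>

definition linear_matching ::
  "nat \<Rightarrow> nat \<Rightarrow> (nat \<Rightarrow> nat \<Rightarrow> real) \<Rightarrow> (nat \<Rightarrow> nat \<Rightarrow> real) \<Rightarrow> (nat \<Rightarrow> nat)"
where
  "linear_matching n d Y Y' = (ARG_MIN (matching_cost n d Y Y') \<pi>. \<pi> permutes {1..n})"

text \<open>
  The random variables \<open>x i k\<close>, \<open>\<epsilon> i k\<close>, \<open>\<epsilon>' i k\<close> are the \<open>k\<close>-th entries of the vectors with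
  index \<open>i\<close>. The law \<open>N(0, \<sigma>\<^sup>2 I\<^sub>d)\<close> is expressed as independence of the coordinates, each being
  \<open>N(0, \<sigma>\<^sup>2)\<close> (the second argument of \<^const>\<open>normal_density\<close> is the standard deviation).
  The index set of the independent family is a disjoint sum: left for \<open>x\<close>, then \<open>\<epsilon>\<close>, then \<open>\<epsilon>'\<close>.
\<close>

locale feature_model = prob_space M
  for M :: "'a measure" and n d :: nat and s \<sigma> :: real and pistar :: "nat \<Rightarrow> nat"
    and x \<epsilon> \<epsilon>' y y' :: "nat \<Rightarrow> nat \<Rightarrow> 'a \<Rightarrow> real" +
  assumes s_pos: "0 < s" and s_le: "s \<le> real d" and sigma_pos: "0 < \<sigma>"
    and pistar: "pistar permutes {1..n}"
    and bernoulli_entries: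
      "\<And>i k. i \<in> {1..n} \<Longrightarrow> k \<in> {1..d} \<Longrightarrow>
         distr M borel (x i k) = distr (bernoulli_pmf (s / real d)) borel of_bool"
    and normal_noise:
      "\<And>i k. i \<in> {1..n} \<Longrightarrow> k \<in> {1..d} \<Longrightarrow> distributed M lborel (\<epsilon> i k) (normal_density 0 \<sigma>)"
    and normal_noise':
      "\<And>i k. i \<in> {1..n} \<Longrightarrow> k \<in> {1..d} \<Longrightarrow> distributed M lborel (\<epsilon>' i k) (normal_density 0 \<sigma>)"
    and independent:
      "indep_vars (\<lambda>_. borel)
         (case_sum (\<lambda>(i, k). x i k) (case_sum (\<lambda>(i, k). \<epsilon> i k) (\<lambda>(i, k). \<epsilon>' i k)))
         (({1..n} \<times> {1..d}) <+> (({1..n} \<times> {1..d}) <+> ({1..n} \<times> {1..d})))"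
    and observed:
      "\<And>i k \<omega>. i \<in> {1..n} \<Longrightarrow> k \<in> {1..d} \<Longrightarrow> \<omega> \<in> space M \<Longrightarrow> y i k \<omega> = x i k \<omega> + \<epsilon> i k \<omega>"
    and observed':
      "\<And>i k \<omega>. i \<in> {1..n} \<Longrightarrow> k \<in> {1..d} \<Longrightarrow> \<omega> \<in> space M \<Longrightarrow>
         y' (pistar i) k \<omega> = x i k \<omega> + \<epsilon>' (pistar i) k \<omega>"

definition recovery_event ::
  "'a measure \<Rightarrow> nat \<Rightarrow> nat \<Rightarrow> (nat \<Rightarrow> nat) \<Rightarrow> (nat \<Rightarrow> nat \<Rightarrow> 'a \<Rightarrow> real) \<Rightarrow>
    (nat \<Rightarrow> nat \<Rightarrow> 'a \<Rightarrow> real) \<Rightarrow> 'a set"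
where
  "recovery_event M n d pistar y y' =
    {\<omega> \<in> space M. linear_matching n d (\<lambda>i k. y i k \<omega>) (\<lambda>i k. y' i k \<omega>) = pistar}"

definition recovery_prob ::
  "'a measure \<Rightarrow> nat \<Rightarrow> nat \<Rightarrow> (nat \<Rightarrow> nat) \<Rightarrow> (nat \<Rightarrow> nat \<Rightarrow> 'a \<Rightarrow> real) \<Rightarrow>
    (nat \<Rightarrow> nat \<Rightarrow> 'a \<Rightarrow> real) \<Rightarrow> real"
where
  "recovery_prob M n d pistar y y' = measure M (recovery_event M n d pistar y y')"

definition dominates :: "(nat \<Rightarrow> real) \<Rightarrow> (nat \<Rightarrow> real) \<Rightarrow> bool"  (infix "\<ggreater>" 50)
where
  "a \<ggreater> b \<longleftrightarrow> (\<lambda>n. b n / a n) \<longlonglongrightarrow> 0"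

text \<open>
  The recovery event is measurable, so that \<^const>\<open>recovery_prob\<close> is a genuine probability and
  not the default value \<open>0\<close> of \<^const>\<open>measure\<close>.
\<close>

context feature_model
begin

lemma measurable_entries:
  assumes "i \<in> {1..n}" "k \<in> {1..d}"
  shows "x i k \<in> borel_measurable M" "\<epsilon> i k \<in> borel_measurable M" "\<epsilon>' i k \<in> borel_measurable M"
proof -
  let ?F = "case_sum (\<lambda>(i, k). x i k) (case_sum (\<lambda>(i, k). \<epsilon> i k) (\<lambda>(i, k). \<epsilon>' i k))"
  let ?J = "({1..n} \<times> {1..d}) <+> (({1..n} \<times> {1..d}) <+> ({1..n} \<times> {1..d}))"
  have *: "\<And>j. j \<in> ?J \<Longrightarrow> ?F j \<in> borel_measurable M"
    using independent by (auto simp only: indep_vars_def)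
  show "x i k \<in> borel_measurable M" using *[OF InlI[of "(i, k)"]] assms by simp
  show "\<epsilon> i k \<in> borel_measurable M" using *[OF InrI[OF InlI[of "(i, k)"]]] assms by simp
  show "\<epsilon>' i k \<in> borel_measurable M" using *[OF InrI[OF InrI[of "(i, k)"]]] assms by simp
qed

lemma measurable_observed:
  assumes "i \<in> {1..n}" "k \<in> {1..d}"
  shows "y i k \<in> borel_measurable M" "y' i k \<in> borel_measurable M"
proof -
  have "(\<lambda>\<omega>. x i k \<omega> + \<epsilon> i k \<omega>) \<in> borel_measurable M"
    using measurable_entries[OF assms] by measurable
  then show "y i k \<in> borel_measurable M"
    by (rule measurable_cong[THEN iffD1, rotated]) (use observed assms in auto)
  obtain j where j: "j \<in> {1..n}" "pistar j = i"
    using permutes_image[OF pistar] assms(1) by (metis imageE)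
  have "(\<lambda>\<omega>. x j k \<omega> + \<epsilon>' i k \<omega>) \<in> borel_measurable M"
    using measurable_entries[OF assms] measurable_entries[OF j(1) assms(2)] by measurable
  then show "y' i k \<in> borel_measurable M"
    by (rule measurable_cong[THEN iffD1, rotated]) (use observed' j assms in force)
qed

lemma measurable_recovery_event: "recovery_event M n d pistar y y' \<in> sets M"
proof -
  define P where "P = {\<pi>. \<pi> permutes {1..n}}"
  define c where "c \<omega> = matching_cost n d (\<lambda>i k. y i k \<omega>) (\<lambda>i k. y' i k \<omega>)" for \<omega>
  have finP: "finite P" unfolding P_def by (simp add: finite_permutations)
  have c_meas: "(\<lambda>\<omega>. c \<omega> \<pi>) \<in> borel_measurable M" if "\<pi> \<in> P" for \<pi>
  proof -
    have "\<pi> i \<in> {1..n}" if "i \<in> {1..n}" for i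
      using \<open>\<pi> \<in> P\<close> that permutes_in_image unfolding P_def by fastforce
    then show ?thesis
      unfolding c_def matching_cost_def L2_set_def
      by (intro borel_measurable_sum borel_measurable_power borel_measurable_diff
          measurable_compose[OF _ borel_measurable_sqrt] measurable_observed)
  qed
  define mins where "mins \<omega> = {\<pi> \<in> P. \<forall>\<tau>\<in>P. c \<omega> \<pi> \<le> c \<omega> \<tau>}" for \<omega>
  have lm: "linear_matching n d (\<lambda>i k. y i k \<omega>) (\<lambda>i k. y' i k \<omega>) = (SOME \<pi>. \<pi> \<in> mins \<omega>)" for \<omega>
    unfolding linear_matching_def arg_min_def is_arg_min_def mins_def P_def c_def
    by (rule arg_cong[where f = Eps]) (auto simp: fun_eq_iff not_less)
  have "recovery_event M n d pistar y y' =
      (\<Union>A\<in>{A \<in> Pow P. (SOME \<pi>. \<pi> \<in> A) = pistar}. {\<omega> \<in> space M. mins \<omega> = A})"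
    unfolding recovery_event_def lm by (auto simp: mins_def)
  also have "\<dots> \<in> sets M"
  proof (rule sets.finite_UN)
    show "finite {A \<in> Pow P. (SOME \<pi>. \<pi> \<in> A) = pistar}" using finP by simp
    fix A assume "A \<in> {A \<in> Pow P. (SOME \<pi>. \<pi> \<in> A) = pistar}"
    then have "{\<omega> \<in> space M. mins \<omega> = A} =
        {\<omega> \<in> space M. \<forall>\<pi>\<in>P. (\<forall>\<tau>\<in>P. c \<omega> \<pi> \<le> c \<omega> \<tau>) \<longleftrightarrow> \<pi> \<in> A}"
      unfolding mins_def by auto
    also have "\<dots> \<in> sets M"
    proof (rule sets.sets_Collect_finite_All[OF _ finP])
      fix \<pi> assume "\<pi> \<in> P"
      then have *: "{\<omega> \<in> space M. \<forall>\<tau>\<in>P. c \<omega> \<pi> \<le> c \<omega> \<tau>} \<in> sets M"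
        using c_meas by (intro sets.sets_Collect_finite_All[OF _ finP] borel_measurable_le)
      show "{\<omega> \<in> space M. (\<forall>\<tau>\<in>P. c \<omega> \<pi> \<le> c \<omega> \<tau>) = (\<pi> \<in> A)} \<in> sets M"
        using * sets.sets_Collect_neg[OF *] by (cases "\<pi> \<in> A") auto
    qed
    finally show "{\<omega> \<in> space M. mins \<omega> = A} \<in> sets M" .
  qed
  finally show ?thesis .
qed

end

end

theory Submission
  imports Defs "HOL-Real_Asymp.Real_Asymp"
begin

text \<open>
  If the matching recovers \<open>\<pi>\<^sup>*\<close>, then no transposition decreases the cost. For the disjoint pairs
  \<open>(i, j) = (2l+1, 2l+2)\<close> this says \<open>\<langle>y\<^sub>i - y\<^sub>j, y'\<^bsub>\<pi>*(i)\<^esub> - y'\<^bsub>\<pi>*(j)\<^esub>\<rangle> \<ge> 0\<close>, and these events are independent, so the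
  probability of recovery is at most the \<open>\<lfloor>n/2\<rfloor>\<close>-th power of a bound for one pair. Put \<open>u = x\<^sub>i - x\<^sub>j\<close>,
  \<open>v = y\<^sub>i - y\<^sub>j\<close> and \<open>\<tau> = \<surd>2 \<sigma>\<close>. Given \<open>v\<close> and \<open>u\<close>, the inner product is normal with mean \<open>\<langle>v, u\<rangle>\<close> and standard
  deviation \<open>\<tau> \<parallel>v\<parallel>\<close>.

  For (i), the probability of nonnegativity is at most \<open>1/2 + \<langle>v, u\<rangle>\<^sup>+ / (\<surd>(2\<pi>) \<tau> \<parallel>v\<parallel>)\<close>; by Cauchy--Schwarz and since
  \<open>\<langle>v, u\<rangle> > 0\<close> itself has probability at most \<open>1/2 + \<parallel>u\<parallel> / (\<surd>(2\<pi>) \<tau>)\<close>, one gets with \<open>w = \<surd>s / \<sigma>\<close> the bound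
  \<open>1/2 + w/5 + 4w\<^sup>2/25\<close>, which is at most \<open>1 - K/(2n)\<close>.

  For (ii), with probability bounded away from 0 one has \<open>\<langle>v, u\<rangle> \<le> \<parallel>u\<parallel>\<^sup>2 \<le> 16 s\<close> and \<open>\<parallel>v\<parallel>\<^sup>2 \<ge> \<tau>\<^sup>2 d / 128\<close>. Then
  the inner product is negative with probability at least \<open>exp (-(q + 1)\<^sup>2 / 2) / 3\<close>, where
  \<open>q = O(s / (\<sigma>\<^sup>2 \<surd>d)) = o(\<surd>(log n))\<close>, so this is at least \<open>n\<^sup>-\<^sup>1\<^sup>/\<^sup>4\<close> up to a constant, and \<open>n/2\<close> independent trials suffice.
\<close>

subsection \<open>Normal distributions and independence\<close>

text \<open>The density never exceeds its peak \<open>1 / (sqrt (2 * pi) * r)\<close>. With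
  \<open>a = b\<close> this also shows that single points are null.\<close>

lemma (in prob_space) prob_normal_le_width:
  assumes Z: "distributed M lborel Z (normal_density \<mu> r)" and r: "0 < r" and "a \<le> b"
  shows "prob {\<omega> \<in> space M. a \<le> Z \<omega> \<and> Z \<omega> \<le> b} \<le> (b - a) / (sqrt (2 * pi) * r)"
proof -
  have "emeasure M (Z -` {a..b} \<inter> space M) =
      (\<integral>\<^sup>+t. ennreal (normal_density \<mu> r t) * indicator {a..b} t \<partial>lborel)"
    by (rule distributed_emeasure[OF Z]) simp
  also have "\<dots> \<le> (\<integral>\<^sup>+t. ennreal (1 / (sqrt (2 * pi) * r)) * indicator {a..b} t \<partial>lborel)"
    using r by (intro nn_integral_mono)
      (auto split: split_indicator simp: normal_density_def real_sqrt_mult divide_simps intro!: ennreal_leI)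
  also have "\<dots> = ennreal ((b - a) / (sqrt (2 * pi) * r))"
    using r \<open>a \<le> b\<close> by (simp add: nn_integral_cmult ennreal_mult[symmetric])
  finally have "prob (Z -` {a..b} \<inter> space M) \<le> (b - a) / (sqrt (2 * pi) * r)"
    using r \<open>a \<le> b\<close> by (simp add: emeasure_eq_measure ennreal_le_iff)
  moreover have "Z -` {a..b} \<inter> space M = {\<omega> \<in> space M. a \<le> Z \<omega> \<and> Z \<omega> \<le> b}"
    by auto
  ultimately show ?thesis by simp
qed

lemma (in prob_space) prob_centered_normal_symmetric:
  assumes Z: "distributed M lborel Z (normal_density 0 r)" and r: "0 < r"
  shows "prob {\<omega> \<in> space M. c \<le> Z \<omega>} = prob {\<omega> \<in> space M. Z \<omega> \<le> - c}"
proof -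
  have *: "distributed M lborel (\<lambda>\<omega>. 0 + (-1) * Z \<omega>) (normal_density (0 + (-1) * 0) (\<bar>-1\<bar> * r))"
    by (rule normal_density_affine[OF Z r]) simp
  then have "distributed M lborel (\<lambda>\<omega>. - Z \<omega>) (normal_density 0 r)" by simp
  from distributed_emeasure[OF this, of "{c..}"] distributed_emeasure[OF Z, of "{c..}"]
  have "prob ((\<lambda>\<omega>. - Z \<omega>) -` {c..} \<inter> space M) = prob (Z -` {c..} \<inter> space M)"
    by (simp add: measure_def)
  moreover have "(\<lambda>\<omega>. - Z \<omega>) -` {c..} \<inter> space M = {\<omega> \<in> space M. Z \<omega> \<le> - c}"
    "Z -` {c..} \<inter> space M = {\<omega> \<in> space M. c \<le> Z \<omega>}" by auto
  ultimately show ?thesis by simp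
qed

text \<open>For \<open>C = max c 0\<close> the events \<open>- C \<le> Z\<close> and
  \<open>Z \<le> C\<close> are equally likely by symmetry. Their probabilities add up to that of the
  union, at most 1, plus that of the overlap \<open>- C \<le> Z \<le> C\<close>, which the width
  bound controls.\<close>

lemma (in prob_space) prob_centered_normal_ge_le:
  assumes Z: "distributed M lborel Z (normal_density 0 r)" and r: "0 < r"
  shows "prob {\<omega> \<in> space M. - c \<le> Z \<omega>} \<le> 1 / 2 + max c 0 / (sqrt (2 * pi) * r)"
proof -
  have Zm[measurable]: "Z \<in> borel_measurable M" using distributed_measurable[OF Z] by simp
  define C where "C = max c 0"
  have C: "0 \<le> C" "c \<le> C" unfolding C_def by auto
  have "prob {\<omega> \<in> space M. - C \<le> Z \<omega>} + prob {\<omega> \<in> space M. Z \<omega> \<le> C} =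
     prob ({\<omega> \<in> space M. - C \<le> Z \<omega>} \<union> {\<omega> \<in> space M. Z \<omega> \<le> C}) +
     prob ({\<omega> \<in> space M. - C \<le> Z \<omega>} \<inter> {\<omega> \<in> space M. Z \<omega> \<le> C})"
    by (subst finite_measure_Union') (auto simp: finite_measure_Diff' Int_commute)
  also have "{\<omega> \<in> space M. - C \<le> Z \<omega>} \<inter> {\<omega> \<in> space M. Z \<omega> \<le> C} =
      {\<omega> \<in> space M. - C \<le> Z \<omega> \<and> Z \<omega> \<le> C}" by auto
  also have "prob {\<omega> \<in> space M. Z \<omega> \<le> C} = prob {\<omega> \<in> space M. - C \<le> Z \<omega>}"
    using prob_centered_normal_symmetric[OF Z r, of "- C"] by simp
  finally have "2 * prob {\<omega> \<in> space M. - C \<le> Z \<omega>} \<le>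
      1 + prob {\<omega> \<in> space M. - C \<le> Z \<omega> \<and> Z \<omega> \<le> C}"
    using prob_le_1[of "{\<omega> \<in> space M. - C \<le> Z \<omega>} \<union> {\<omega> \<in> space M. Z \<omega> \<le> C}"] by linarith
  also have "\<dots> \<le> 1 + (C - - C) / (sqrt (2 * pi) * r)"
    using prob_normal_le_width[OF Z r, of "- C" C] C by simp
  finally have "prob {\<omega> \<in> space M. - C \<le> Z \<omega>} \<le> 1 / 2 + C / (sqrt (2 * pi) * r)"
    by simp
  moreover have "prob {\<omega> \<in> space M. - c \<le> Z \<omega>} \<le> prob {\<omega> \<in> space M. - C \<le> Z \<omega>}"
    using C by (intro finite_measure_mono) auto
  ultimately show ?thesis unfolding C_def by simp
qed

text \<open>The event misses the interval of length \<open>r\<close> just below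
  \<open>- (r * q)\<close>. There \<open>\<bar>t\<bar> \<le> r * (q + 1)\<close>, which bounds the
  density from below.\<close>

lemma (in prob_space) prob_centered_normal_ge_le_tail:
  assumes Z: "distributed M lborel Z (normal_density 0 r)" and r: "0 < r"
    and c: "c \<le> r * q" "0 \<le> q"
  shows "prob {\<omega> \<in> space M. - c \<le> Z \<omega>} \<le> 1 - exp (- ((q + 1)\<^sup>2 / 2)) / sqrt (2 * pi)"
proof -
  have Zm[measurable]: "Z \<in> borel_measurable M" using distributed_measurable[OF Z] by simp
  define I where "I = {- (r * q) - r..<- (r * q)}"
  have "ennreal (exp (- ((q + 1)\<^sup>2 / 2)) / sqrt (2 * pi)) =
      (\<integral>\<^sup>+t. ennreal (exp (- ((q + 1)\<^sup>2 / 2)) / (sqrt (2 * pi) * r)) * indicator I t \<partial>lborel)"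
    using r by (simp add: nn_integral_cmult ennreal_mult[symmetric] I_def)
  also have "\<dots> \<le> (\<integral>\<^sup>+t. ennreal (normal_density 0 r t) * indicator I t \<partial>lborel)"
  proof (intro nn_integral_mono)
    fix t
    have "exp (- ((q + 1)\<^sup>2 / 2)) / (sqrt (2 * pi) * r) \<le> normal_density 0 r t" if "t \<in> I"
    proof -
      have "0 \<le> r * q" using r c by simp
      then have "\<bar>t\<bar> \<le> \<bar>r * (q + 1)\<bar>" using that r unfolding I_def by (auto simp: algebra_simps)
      then have "t\<^sup>2 \<le> r\<^sup>2 * (q + 1)\<^sup>2" by (metis abs_le_square_iff power_mult_distrib)
      then have "t\<^sup>2 / (2 * r\<^sup>2) \<le> (q + 1)\<^sup>2 / 2" using r by (simp add: field_simps)
      then show ?thesis using r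
        by (simp add: normal_density_def real_sqrt_mult divide_right_mono)
    qed
    then show "ennreal (exp (- ((q + 1)\<^sup>2 / 2)) / (sqrt (2 * pi) * r)) * indicator I t \<le>
        ennreal (normal_density 0 r t) * indicator I t"
      by (auto split: split_indicator intro: ennreal_leI)
  qed
  also have "\<dots> = emeasure M (Z -` I \<inter> space M)"
    by (rule distributed_emeasure[OF Z, symmetric]) (simp add: I_def)
  finally have "exp (- ((q + 1)\<^sup>2 / 2)) / sqrt (2 * pi) \<le> prob (Z -` I \<inter> space M)"
    by (simp add: emeasure_eq_measure)
  also have "\<dots> \<le> prob (space M - {\<omega> \<in> space M. - c \<le> Z \<omega>})"
    using c by (intro finite_measure_mono) (auto simp: I_def)
  also have "\<dots> = 1 - prob {\<omega> \<in> space M. - c \<le> Z \<omega>}"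
    by (rule prob_compl) simp
  finally show ?thesis by simp
qed

lemma (in prob_space) distributed_normal_linear_form:
  fixes v :: "'i \<Rightarrow> real"
  assumes "finite I" and ind: "indep_vars (\<lambda>_. borel) f I" and \<tau>: "0 < \<tau>"
    and f: "\<And>k. k \<in> I \<Longrightarrow> distributed M lborel (f k) (normal_density 0 \<tau>)"
    and v: "0 < (\<Sum>k\<in>I. (v k)\<^sup>2)"
  shows "distributed M lborel (\<lambda>\<omega>. \<Sum>k\<in>I. v k * f k \<omega>) (normal_density 0 (\<tau> * sqrt (\<Sum>k\<in>I. (v k)\<^sup>2)))"
proof -
  \<comment> \<open>A zero coefficient would give a degenerate summand without a density, so these
    indices are dropped before the summation theorem for independent normal variables is
    applied.\<close>
  define J where "J = {k \<in> I. v k \<noteq> 0}"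
  have J: "finite J" "J \<subseteq> I" using \<open>finite I\<close> unfolding J_def by auto
  have eqJ: "(\<Sum>k\<in>I. (v k)\<^sup>2) = (\<Sum>k\<in>J. (v k)\<^sup>2)"
    using \<open>finite I\<close> by (intro sum.mono_neutral_right) (auto simp: J_def)
  then have "J \<noteq> {}" using v by auto
  have 1: "indep_vars (\<lambda>_. borel) (\<lambda>k \<omega>. v k * f k \<omega>) J"
    by (rule indep_vars_compose2[OF indep_vars_subset[OF ind J(2)]]) measurable
  have 2: "distributed M lborel (\<lambda>\<omega>. v k * f k \<omega>) (normal_density 0 (\<bar>v k\<bar> * \<tau>))" if "k \<in> J" for k
    using normal_density_affine[OF f \<tau>, of k "v k" 0] that by (auto simp: J_def)
  have "distributed M lborel (\<lambda>\<omega>. \<Sum>k\<in>J. v k * f k \<omega>)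
      (normal_density (\<Sum>k\<in>J. 0) (sqrt (\<Sum>k\<in>J. (\<bar>v k\<bar> * \<tau>)\<^sup>2)))"
    using 2 \<tau> by (intro sum_indep_normal J(1) \<open>J \<noteq> {}\<close> 1) (auto simp: J_def)
  moreover have "sqrt (\<Sum>k\<in>J. (\<bar>v k\<bar> * \<tau>)\<^sup>2) = \<tau> * sqrt (\<Sum>k\<in>I. (v k)\<^sup>2)"
    using \<tau> by (simp add: power_mult_distrib sum_distrib_right[symmetric] real_sqrt_mult eqJ)
  moreover have "(\<lambda>\<omega>. \<Sum>k\<in>I. v k * f k \<omega>) = (\<lambda>\<omega>. \<Sum>k\<in>J. v k * f k \<omega>)"
    using \<open>finite I\<close> by (intro ext sum.mono_neutral_right) (auto simp: J_def)
  ultimately show ?thesis by simp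
qed

text \<open>This takes the place of conditioning on \<open>X\<close>: by independence the joint law
  is a product, so by Fubini a bound \<open>h a\<close> that holds with \<open>X\<close> frozen at
  \<open>a\<close> may be averaged over the law of \<open>X\<close>.\<close>

lemma (in prob_space) indep_var_prob_le:
  assumes ind: "indep_var S X T Y"
    and Q[measurable]: "Measurable.pred (S \<Otimes>\<^sub>M T) (\<lambda>p. Q (fst p) (snd p))"
    and bound: "\<And>a. a \<in> space S \<Longrightarrow> prob {\<omega> \<in> space M. Q a (Y \<omega>)} \<le> h a"
    and h[measurable]: "h \<in> borel_measurable S" and int: "integrable M (\<lambda>\<omega>. h (X \<omega>))"
  shows "prob {\<omega> \<in> space M. Q (X \<omega>) (Y \<omega>)} \<le> expectation (\<lambda>\<omega>. h (X \<omega>))"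
proof -
  have [measurable]: "X \<in> measurable M S" "Y \<in> measurable M T"
    and eq: "distr M (S \<Otimes>\<^sub>M T) (\<lambda>x. (X x, Y x)) = distr M S X \<Otimes>\<^sub>M distr M T Y"
    using ind by (auto simp: indep_var_distribution_eq)
  interpret Y: prob_space "distr M T Y" by (rule prob_space_distr) simp
  have nonneg: "0 \<le> h a" if "a \<in> space S" for a
    using bound[OF that] measure_nonneg[of M] by (rule order_trans[rotated])
  define A where "A = {p \<in> space (S \<Otimes>\<^sub>M T). Q (fst p) (snd p)}"
  have A[measurable]: "A \<in> sets (S \<Otimes>\<^sub>M T)" unfolding A_def by measurable
  have A': "A \<in> sets (distr M S X \<Otimes>\<^sub>M distr M T Y)" using A by (simp cong: sets_pair_measure_cong)
  have "emeasure M {\<omega> \<in> space M. Q (X \<omega>) (Y \<omega>)} = emeasure (distr M (S \<Otimes>\<^sub>M T) (\<lambda>x. (X x, Y x))) A"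
    by (subst emeasure_distr)
      (auto simp: A_def space_pair_measure intro!: arg_cong[where f="emeasure M"]
        dest: measurable_space[OF \<open>X \<in> measurable M S\<close>] measurable_space[OF \<open>Y \<in> measurable M T\<close>])
  also have "\<dots> = (\<integral>\<^sup>+a. emeasure (distr M T Y) (Pair a -` A) \<partial>distr M S X)"
    unfolding eq by (rule Y.emeasure_pair_measure_alt[OF A'])
  also have "\<dots> \<le> (\<integral>\<^sup>+a. ennreal (h a) \<partial>distr M S X)"
  proof (rule nn_integral_mono)
    fix a assume "a \<in> space (distr M S X)"
    then have a: "a \<in> space S" by simp
    have "emeasure (distr M T Y) (Pair a -` A) = emeasure M {\<omega> \<in> space M. Q a (Y \<omega>)}"
      using a sets_Pair1[OF A, of a]
      by (subst emeasure_distr) (auto simp: A_def space_pair_measure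
          intro!: arg_cong[where f="emeasure M"] dest: measurable_space[OF \<open>Y \<in> measurable M T\<close>])
    also have "\<dots> \<le> ennreal (h a)"
      using bound[OF a] by (simp add: emeasure_eq_measure ennreal_leI)
    finally show "emeasure (distr M T Y) (Pair a -` A) \<le> ennreal (h a)" .
  qed
  also have "\<dots> = (\<integral>\<^sup>+\<omega>. ennreal (h (X \<omega>)) \<partial>M)"
    by (rule nn_integral_distr) measurable
  also have "\<dots> = ennreal (expectation (\<lambda>\<omega>. h (X \<omega>)))"
    by (rule nn_integral_eq_integral[OF int])
      (auto intro!: AE_I2 nonneg measurable_space[OF \<open>X \<in> measurable M S\<close>])
  finally show ?thesis
    by (simp add: emeasure_eq_measure ennreal_le_iff integral_nonneg
        nonneg measurable_space[OF \<open>X \<in> measurable M S\<close>])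
qed

lemma sqrt_2_pi_bounds: "5 / 2 \<le> sqrt (2 * pi)" "sqrt (2 * pi) \<le> 3"
  by (rule real_le_rsqrt) (use pi_approx in \<open>simp_all add: power2_eq_square real_le_lsqrt\<close>)

context prob_space
begin

lemma indep_vars_reindex_const:
  assumes "inj_on g I" "indep_vars (\<lambda>_. N) X (g ` I)"
  shows "indep_vars (\<lambda>_. N) (\<lambda>i. X (g i)) I"
proof -
  have "indep_vars (\<lambda>i. PiM {g i} (\<lambda>_. N)) (\<lambda>i \<omega>. \<lambda>j\<in>{g i}. X j \<omega>) I"
    by (rule indep_vars_restrict[OF assms(2)])
      (use assms(1) in \<open>auto simp: disjoint_family_on_def inj_on_def\<close>)
  then have "indep_vars (\<lambda>_. N) (\<lambda>i \<omega>. (\<lambda>j\<in>{g i}. X j \<omega>) (g i)) I"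
    by (rule indep_vars_compose2) measurable
  then show ?thesis by simp
qed

lemma expectation_affine_indicators:
  assumes "A \<in> events" "B \<in> events"
  shows "expectation (\<lambda>\<omega>. a + b * indicator A \<omega> + indicator B \<omega>) = a + b * prob A + prob B"
  using assms by (simp add: prob_space integrable_real_indicator emeasure_eq_measure)

lemma expectation_affine_indicator:
  assumes "A \<in> events"
  shows "expectation (\<lambda>\<omega>. a - b * indicator A \<omega>) = a - b * prob A"
  using expectation_affine_indicators[OF assms sets.empty_sets, of a "- b"] by simp

subsection \<open>The quadratic form of one pair\<close>

text \<open>
  For a pair of vertices, \<open>u k\<close> (later \<open>Z (0, k)\<close>), \<open>Z (1, k)\<close> and \<open>Z (2, k)\<close> are the differences of the
  \<open>k\<close>-th coordinates of the two features, of the noise in \<open>y\<close> and of the noise in \<open>y'\<close>. Swapping the pair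
  does not decrease the cost iff the quadratic form below is nonnegative.
\<close>

context
  fixes I :: "'i set" and Z :: "nat \<times> 'i \<Rightarrow> 'a \<Rightarrow> real" and u :: "'i \<Rightarrow> real" and \<tau> :: real
  assumes finite_I: "finite I" and nonempty_I: "I \<noteq> {}" and \<tau>_pos: "0 < \<tau>"
    and indep_Z: "indep_vars (\<lambda>_. borel) Z ({1, 2} \<times> I)"
    and normal_Z: "\<And>j. j \<in> {1, 2} \<times> I \<Longrightarrow> distributed M lborel (Z j) (normal_density 0 \<tau>)"
begin

lemma measurable_noise: "j \<in> {1, 2} \<times> I \<Longrightarrow> Z j \<in> borel_measurable M"
  using distributed_measurable[OF normal_Z] by simp

lemma indep_noise_row:
  assumes "t \<in> {1, 2}"
  shows "indep_vars (\<lambda>_. borel) (\<lambda>k. Z (t, k)) I"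
  by (rule indep_vars_reindex_const, simp add: inj_on_def, rule indep_vars_subset[OF indep_Z])
    (use assms in auto)

lemma distributed_noise_form:
  assumes "t \<in> {1, 2}" "L2_set v I \<noteq> 0"
  shows "distributed M lborel (\<lambda>\<omega>. \<Sum>k\<in>I. v k * Z (t, k) \<omega>) (normal_density 0 (\<tau> * L2_set v I))"
proof -
  have "0 < (\<Sum>k\<in>I. (v k)\<^sup>2)"
    using assms(2) L2_set_nonneg[of v I] unfolding L2_set_def
    by (metis real_sqrt_gt_0_iff less_eq_real_def)
  from distributed_normal_linear_form[OF finite_I indep_noise_row[OF assms(1)] \<tau>_pos normal_Z this]
  show ?thesis using assms(1) by (auto simp: L2_set_def)
qed

lemma indep_noise_rows:
  "indep_var (PiM ({1} \<times> I) (\<lambda>_. borel)) (\<lambda>\<omega>. \<lambda>j\<in>{1} \<times> I. Z j \<omega>)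
     (PiM ({2} \<times> I) (\<lambda>_. borel)) (\<lambda>\<omega>. \<lambda>j\<in>{2} \<times> I. Z j \<omega>)"
  by (rule indep_var_restrict[OF indep_Z]) auto

lemma correlation_split:
  "(\<Sum>k\<in>I. v k * (u k + f k)) = (\<Sum>k\<in>I. v k * u k) + (\<Sum>k\<in>I. v k * f k)" for v f :: "'i \<Rightarrow> real"
  by (simp add: algebra_simps sum.distrib)

lemma prob_correlation_le:
  fixes v :: "'i \<Rightarrow> real"
  assumes "L2_set v I \<noteq> 0"
  shows "prob {\<omega> \<in> space M. 0 \<le> (\<Sum>k\<in>I. v k * (u k + Z (2, k) \<omega>))}
    \<le> 1 / 2 + 2 / 5 * (max (\<Sum>k\<in>I. v k * u k) 0 / (\<tau> * L2_set v I))"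
proof -
  let ?c = "\<Sum>k\<in>I. v k * u k"
  have r: "0 < \<tau> * L2_set v I" using assms \<tau>_pos L2_set_nonneg[of v I] by (simp add: less_le)
  have "prob {\<omega> \<in> space M. - ?c \<le> (\<Sum>k\<in>I. v k * Z (2, k) \<omega>)}
      \<le> 1 / 2 + max ?c 0 / (sqrt (2 * pi) * (\<tau> * L2_set v I))"
    by (rule prob_centered_normal_ge_le[OF distributed_noise_form[OF _ assms] r]) simp
  also have "max ?c 0 / (sqrt (2 * pi) * (\<tau> * L2_set v I)) \<le> max ?c 0 / (5 / 2 * (\<tau> * L2_set v I))"
    using r sqrt_2_pi_bounds(1) by (intro divide_left_mono mult_right_mono mult_pos_pos[OF _ r]) auto
  also have "{\<omega> \<in> space M. - ?c \<le> (\<Sum>k\<in>I. v k * Z (2, k) \<omega>)} =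
      {\<omega> \<in> space M. 0 \<le> (\<Sum>k\<in>I. v k * (u k + Z (2, k) \<omega>))}"
    unfolding correlation_split by (intro Collect_cong conj_cong refl) linarith
  finally show ?thesis by (simp add: algebra_simps)
qed

text \<open>With the row-1 noise frozen, the sum is normal with a mean-to-deviation ratio of at most
  \<open>w\<close> by Cauchy-Schwarz, and at most 0 unless \<open>P\<close> holds. Averaging gives
  \<open>1 / 2 + 2 / 5 * w * prob P\<close>, and \<open>prob P\<close> is itself at most
  \<open>1 / 2 + 2 / 5 * w\<close>.\<close>

lemma prob_quadratic_form_le:
  fixes w :: real
  assumes w: "w = L2_set u I / \<tau>"
  shows "prob {\<omega> \<in> space M. 0 \<le> (\<Sum>k\<in>I. (u k + Z (1, k) \<omega>) * (u k + Z (2, k) \<omega>))}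
    \<le> 1 / 2 + w / 5 + 4 / 25 * w\<^sup>2"
proof -
  let ?S = "PiM ({1::nat} \<times> I) (\<lambda>_. borel :: real measure)"
  let ?T = "PiM ({2::nat} \<times> I) (\<lambda>_. borel :: real measure)"
  let ?X = "\<lambda>\<omega>. \<lambda>j\<in>{1} \<times> I. Z j \<omega>"
  let ?Y = "\<lambda>\<omega>. \<lambda>j\<in>{2} \<times> I. Z j \<omega>"
  define V where "V a k = u k + a (1::nat, k)" for a k
  define Q where "Q a b \<longleftrightarrow> 0 \<le> (\<Sum>k\<in>I. V a k * (u k + b (2::nat, k)))" for a b
  define P where "P a \<longleftrightarrow> 0 < (\<Sum>k\<in>I. V a k * u k)" for a
  define N where "N a \<longleftrightarrow> (\<forall>k\<in>I. V a k = 0)" for a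
  define h where "h a = 1 / 2 + 2 / 5 * w * of_bool (P a) + of_bool (N a)" for a
  have w0: "0 \<le> w" using w \<tau>_pos by simp
  have Vm[measurable]: "(\<lambda>a. V a k) \<in> borel_measurable ?S" if "k \<in> I" for k
  proof -
    have [measurable]: "(1, k) \<in> {1::nat} \<times> I" using that by simp
    show ?thesis unfolding V_def by measurable
  qed
  have Pm[measurable]: "Measurable.pred ?S P"
    unfolding P_def by measurable
  have Nm[measurable]: "Measurable.pred ?S N"
    unfolding N_def using finite_I by measurable
  have hm[measurable]: "h \<in> borel_measurable ?S"
    unfolding h_def by measurable
  have Xm[measurable]: "?X \<in> measurable M ?S" "?Y \<in> measurable M ?T"
    by (auto intro!: measurable_restrict measurable_noise)
  have X1: "V (?X \<omega>) k = u k + Z (1, k) \<omega>" if "k \<in> I" for k \<omega>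
    using that by (simp add: V_def)
  have "prob {\<omega> \<in> space M. Q (?X \<omega>) (?Y \<omega>)} \<le> expectation (\<lambda>\<omega>. h (?X \<omega>))"
  proof (rule indep_var_prob_le[OF indep_noise_rows])
    show "Measurable.pred (?S \<Otimes>\<^sub>M ?T) (\<lambda>p. Q (fst p) (snd p))"
      unfolding Q_def V_def by measurable
    show "h \<in> borel_measurable ?S" by (rule hm)
    show "integrable M (\<lambda>\<omega>. h (?X \<omega>))"
      by (rule integrable_const_bound[where B="2 + w", OF _ measurable_compose[OF Xm(1) hm]])
        (use w0 in \<open>auto simp: h_def\<close>)
    fix a
    show "prob {\<omega> \<in> space M. Q a (?Y \<omega>)} \<le> h a"
    proof (cases "N a")
      case True
      then have "1 \<le> h a" using w0 by (auto simp: h_def)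
      then show ?thesis by (rule order_trans[OF prob_le_1])
    next
      case False
      then have v: "L2_set (V a) I \<noteq> 0"
        using finite_I by (simp add: L2_set_eq_0_iff N_def)
      then have v': "0 < L2_set (V a) I" using L2_set_nonneg[of "V a" I] by linarith
      have "max (\<Sum>k\<in>I. V a k * u k) 0 / (\<tau> * L2_set (V a) I) \<le> w * of_bool (P a)"
      proof (cases "P a")
        case True
        have "(\<Sum>k\<in>I. V a k * u k) \<le> (\<Sum>k\<in>I. \<bar>V a k\<bar> * \<bar>u k\<bar>)"
          by (intro sum_mono) (metis abs_ge_self abs_mult)
        also have "\<dots> \<le> L2_set (V a) I * L2_set u I" by (rule L2_set_mult_ineq)
        also have "\<dots> = w * (\<tau> * L2_set (V a) I)" using w \<tau>_pos by simp
        finally show ?thesis using True v' \<tau>_pos by (simp add: P_def divide_le_eq)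
      qed (simp add: P_def)
      then have "1 / 2 + 2 / 5 * (max (\<Sum>k\<in>I. V a k * u k) 0 / (\<tau> * L2_set (V a) I)) \<le> h a"
        using False by (simp add: h_def)
      moreover have "{\<omega> \<in> space M. Q a (?Y \<omega>)} =
          {\<omega> \<in> space M. 0 \<le> (\<Sum>k\<in>I. V a k * (u k + Z (2, k) \<omega>))}"
        by (auto simp: Q_def cong: sum.cong)
      ultimately show ?thesis using prob_correlation_le[OF v] by simp
    qed
  qed
  also have "expectation (\<lambda>\<omega>. h (?X \<omega>)) = 1 / 2 + 2 / 5 * w * prob {\<omega> \<in> space M. P (?X \<omega>)}
      + prob {\<omega> \<in> space M. N (?X \<omega>)}"
  proof -
    have "expectation (\<lambda>\<omega>. h (?X \<omega>)) = expectation (\<lambda>\<omega>. 1 / 2 +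
        2 / 5 * w * indicator {\<omega> \<in> space M. P (?X \<omega>)} \<omega> + indicator {\<omega> \<in> space M. N (?X \<omega>)} \<omega>)"
      by (intro Bochner_Integration.integral_cong) (auto simp: h_def)
    also have "\<dots> = 1 / 2 + 2 / 5 * w * prob {\<omega> \<in> space M. P (?X \<omega>)} + prob {\<omega> \<in> space M. N (?X \<omega>)}"
      by (rule expectation_affine_indicators; measurable)
    finally show ?thesis .
  qed
  also have "prob {\<omega> \<in> space M. N (?X \<omega>)} \<le> 0"
  proof -
    \<comment> \<open>A single coordinate suffices: it would have to hit the point
      \<open>- u k\<close> exactly.\<close>
    obtain k where k: "k \<in> I" using nonempty_I by auto
    then have d: "distributed M lborel (Z (1, k)) (normal_density 0 \<tau>)" by (intro normal_Z) auto
    have "prob {\<omega> \<in> space M. N (?X \<omega>)} \<le> prob {\<omega> \<in> space M. - u k \<le> Z (1, k) \<omega> \<and> Z (1, k) \<omega> \<le> - u k}"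
      using k measurable_noise[of "(1, k)"] by (intro finite_measure_mono) (auto simp: N_def X1[unfolded One_nat_def])
    also have "\<dots> \<le> 0" using prob_normal_le_width[OF d \<tau>_pos, of "- u k" "- u k"] by simp
    finally show ?thesis .
  qed
  \<comment> \<open>\<open>P\<close> says that the linear form of the row-1 noise with coefficients
    \<open>u\<close> exceeds minus the squared norm of \<open>u\<close>, so the half-line estimate
    applies a second time. This halves the coefficient of \<open>w\<close> from 2/5 to 1/5.\<close>
  also have "2 / 5 * w * prob {\<omega> \<in> space M. P (?X \<omega>)} \<le> 2 / 5 * w * (1 / 2 + 2 / 5 * w)"
  proof (cases "w = 0")
    case False
    then have u: "L2_set u I \<noteq> 0" using w by auto
    then have r: "0 < \<tau> * L2_set u I" using \<tau>_pos L2_set_nonneg[of u I] by (simp add: less_le)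
    let ?F = "\<lambda>\<omega>. \<Sum>k\<in>I. u k * Z (1, k) \<omega>"
    have sq: "(\<Sum>k\<in>I. u k * u k) = (L2_set u I)\<^sup>2"
      by (simp add: L2_set_def sum_nonneg power2_eq_square[symmetric])
    have d: "distributed M lborel ?F (normal_density 0 (\<tau> * L2_set u I))"
      by (rule distributed_noise_form[OF _ u]) simp
    have [measurable]: "?F \<in> borel_measurable M" using distributed_measurable[OF d] by simp
    have "prob {\<omega> \<in> space M. P (?X \<omega>)} \<le> prob {\<omega> \<in> space M. - (L2_set u I)\<^sup>2 \<le> ?F \<omega>}"
    proof (intro finite_measure_mono subsetI CollectI conjI; (elim CollectE conjE)?)
      fix \<omega> assume "\<omega> \<in> space M" "P (?X \<omega>)"
      have "(\<Sum>k\<in>I. V (?X \<omega>) k * u k) = (\<Sum>k\<in>I. u k * u k + u k * Z (1, k) \<omega>)"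
        by (intro sum.cong) (auto simp: X1[unfolded One_nat_def] algebra_simps)
      then show "- (L2_set u I)\<^sup>2 \<le> ?F \<omega>"
        using \<open>P (?X \<omega>)\<close> by (simp add: P_def sum.distrib sq)
    qed (use distributed_measurable[OF d] in simp_all)
    also have "\<dots> \<le> 1 / 2 + max ((L2_set u I)\<^sup>2) 0 / (sqrt (2 * pi) * (\<tau> * L2_set u I))"
      by (rule prob_centered_normal_ge_le[OF d r])
    also have "\<dots> = 1 / 2 + w / sqrt (2 * pi)"
      using u w by (simp add: power2_eq_square)
    also have "\<dots> \<le> 1 / 2 + w / (5 / 2)"
      using sqrt_2_pi_bounds w0 by (intro add_left_mono divide_left_mono mult_pos_pos) auto
    also have "\<dots> = 1 / 2 + 2 / 5 * w" by simp
    finally have "prob {\<omega> \<in> space M. P (?X \<omega>)} \<le> 1 / 2 + 2 / 5 * w" .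
    moreover have "0 \<le> 2 / 5 * w" using w0 by simp
    ultimately show ?thesis by (rule mult_left_mono)
  qed simp
  finally have "prob {\<omega> \<in> space M. Q (?X \<omega>) (?Y \<omega>)} \<le> 1 / 2 + w / 5 + 4 / 25 * w\<^sup>2"
    by (simp add: algebra_simps power2_eq_square)
  moreover have "{\<omega> \<in> space M. Q (?X \<omega>) (?Y \<omega>)} =
      {\<omega> \<in> space M. 0 \<le> (\<Sum>k\<in>I. (u k + Z (1, k) \<omega>) * (u k + Z (2, k) \<omega>))}"
    by (auto simp: Q_def X1[unfolded One_nat_def] cong: sum.cong)
  ultimately show ?thesis by simp
qed


section \<open>Tail bounds for a fixed feature difference\<close>

lemma prob_correlation_le_tail:
  fixes v :: "'i \<Rightarrow> real"
  assumes v: "L2_set v I \<noteq> 0" and q: "(\<Sum>k\<in>I. v k * u k) \<le> \<tau> * L2_set v I * q" "0 \<le> q"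
  shows "prob {\<omega> \<in> space M. 0 \<le> (\<Sum>k\<in>I. v k * (u k + Z (2, k) \<omega>))}
    \<le> 1 - exp (- ((q + 1)\<^sup>2 / 2)) / 3"
proof -
  let ?c = "\<Sum>k\<in>I. v k * u k"
  have r: "0 < \<tau> * L2_set v I" using v \<tau>_pos L2_set_nonneg[of v I] by (simp add: less_le)
  have "prob {\<omega> \<in> space M. - ?c \<le> (\<Sum>k\<in>I. v k * Z (2, k) \<omega>)}
      \<le> 1 - exp (- ((q + 1)\<^sup>2 / 2)) / sqrt (2 * pi)"
    by (rule prob_centered_normal_ge_le_tail[OF distributed_noise_form[OF _ v] r q]) simp
  also have "{\<omega> \<in> space M. - ?c \<le> (\<Sum>k\<in>I. v k * Z (2, k) \<omega>)} =
      {\<omega> \<in> space M. 0 \<le> (\<Sum>k\<in>I. v k * (u k + Z (2, k) \<omega>))}"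
    unfolding correlation_split by (intro Collect_cong conj_cong refl) linarith
  moreover have "exp (- ((q + 1)\<^sup>2 / 2)) / 3 \<le> exp (- ((q + 1)\<^sup>2 / 2)) / sqrt (2 * pi)"
    using sqrt_2_pi_bounds by (intro divide_left_mono mult_pos_pos) auto
  ultimately show ?thesis by simp
qed

text \<open>If the norm is small, then at least half of the coordinates lie in \<open>[-\<tau>/8, \<tau>/8]\<close>.\<close>

lemma prob_norm_small:
  "prob {\<omega> \<in> space M. (\<Sum>k\<in>I. (u k + Z (1, k) \<omega>)\<^sup>2) < \<tau>\<^sup>2 * card I / 128} \<le> 1 / 5"
proof -
  let ?v = "\<lambda>k \<omega>. u k + Z (1, k) \<omega>"
  let ?A = "{\<omega> \<in> space M. (\<Sum>k\<in>I. (?v k \<omega>)\<^sup>2) < \<tau>\<^sup>2 * card I / 128}"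
  let ?B = "\<lambda>k. {\<omega> \<in> space M. - u k - \<tau> / 8 \<le> Z (1, k) \<omega> \<and> Z (1, k) \<omega> \<le> - u k + \<tau> / 8}"
  have d: "0 < real (card I)" using finite_I nonempty_I by (simp add: card_gt_0_iff)
  have Zm[measurable]: "Z (1, k) \<in> borel_measurable M" if "k \<in> I" for k
    using that by (intro measurable_noise) auto
  have A[measurable]: "?A \<in> events" by measurable
  have B[measurable]: "?B k \<in> events" if "k \<in> I" for k using Zm[OF that] by measurable
  have "prob ?A = expectation (\<lambda>\<omega>. indicator ?A \<omega>)" using A by simp
  \<comment> \<open>Markov's inequality for the number of coordinates in the interval: on
    \<open>?A\<close> these are at least half of all, so \<open>2 / card I\<close> times their
    number is at least 1.\<close>
  also have "\<dots> \<le> expectation (\<lambda>\<omega>. 2 / card I * (\<Sum>k\<in>I. indicator (?B k) \<omega>))"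
  proof (rule integral_mono)
    show "integrable M (\<lambda>\<omega>. indicator ?A \<omega> :: real)"
      by (rule integrable_real_indicator[OF A]) (simp add: emeasure_eq_measure)
    show "integrable M (\<lambda>\<omega>. 2 / card I * (\<Sum>k\<in>I. indicator (?B k) \<omega>) :: real)"
      by (intro integrable_mult_right Bochner_Integration.integrable_sum
          integrable_real_indicator[OF B]) (simp_all add: emeasure_eq_measure)
    fix \<omega> assume \<omega>: "\<omega> \<in> space M"
    show "indicator ?A \<omega> \<le> 2 / card I * (\<Sum>k\<in>I. indicator (?B k) \<omega> :: real)"
    proof (cases "\<omega> \<in> ?A")
      case True
      have "\<tau>\<^sup>2 / 64 * (1 - indicator (?B k) \<omega>) \<le> (?v k \<omega>)\<^sup>2" for k
      proof (cases "\<omega> \<in> ?B k")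
        case False
        then have "\<bar>\<tau> / 8\<bar> \<le> \<bar>?v k \<omega>\<bar>" using \<omega> \<tau>_pos by (auto simp: abs_if)
        then have "(\<tau> / 8)\<^sup>2 \<le> (?v k \<omega>)\<^sup>2" by (simp only: abs_le_square_iff)
        then show ?thesis using False by (simp add: power_divide)
      qed simp
      then have "(\<Sum>k\<in>I. \<tau>\<^sup>2 / 64 * (1 - indicator (?B k) \<omega>)) \<le> (\<Sum>k\<in>I. (?v k \<omega>)\<^sup>2)"
        by (rule sum_mono)
      also have "\<dots> < \<tau>\<^sup>2 * card I / 128" using True by simp
      also have "(\<Sum>k\<in>I. \<tau>\<^sup>2 / 64 * (1 - indicator (?B k) \<omega>)) =
          \<tau>\<^sup>2 / 64 * (real (card I) - (\<Sum>k\<in>I. indicator (?B k) \<omega>))"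
        unfolding sum_distrib_left[symmetric] sum_subtractf by simp
      finally have "\<tau>\<^sup>2 * (real (card I) - (\<Sum>k\<in>I. indicator (?B k) \<omega>)) < \<tau>\<^sup>2 * (card I / 2)"
        by (simp del: of_nat_sum)
      then have "card I / 2 \<le> (\<Sum>k\<in>I. indicator (?B k) \<omega> :: real)"
        using \<tau>_pos by simp
      then show ?thesis using True d by (simp add: field_simps)
    qed (simp add: sum_nonneg)
  qed
  also have "\<dots> = 2 / card I * (\<Sum>k\<in>I. prob (?B k))"
  proof -
    have "expectation (\<lambda>\<omega>. \<Sum>k\<in>I. indicat_real (?B k) \<omega>) = (\<Sum>k\<in>I. expectation (indicator (?B k)))"
      by (rule Bochner_Integration.integral_sum, rule integrable_real_indicator[OF B])
        (simp_all add: emeasure_eq_measure)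
    also have "\<dots> = (\<Sum>k\<in>I. prob (?B k))"
      by (intro sum.cong refl) (subst Bochner_Integration.integral_indicator, rule arg_cong[where f=prob], auto)
    finally show ?thesis by simp
  qed
  \<comment> \<open>Each interval has length \<open>\<tau> / 4\<close>, hence probability at most
    \<open>(1 / 4) / (5 / 2)\<close>.\<close>
  also have "\<dots> \<le> 2 / card I * (\<Sum>k\<in>I. 1 / 10)"
  proof (intro mult_left_mono sum_mono)
    fix k assume "k \<in> I"
    then have n: "distributed M lborel (Z (1, k)) (normal_density 0 \<tau>)" by (intro normal_Z) auto
    have "prob (?B k) \<le> ((- u k + \<tau> / 8) - (- u k - \<tau> / 8)) / (sqrt (2 * pi) * \<tau>)"
      by (rule prob_normal_le_width[OF n \<tau>_pos]) (use \<tau>_pos in simp)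
    also have "\<dots> = (1 / 4) / sqrt (2 * pi)" using \<tau>_pos by (simp add: field_simps)
    also have "\<dots> \<le> (1 / 4) / (5 / 2)"
      using sqrt_2_pi_bounds by (intro divide_left_mono mult_pos_pos) auto
    finally show "prob (?B k) \<le> 1 / 10" by simp
  qed simp
  also have "\<dots> = 1 / 5" using d by simp
  finally show ?thesis .
qed

text \<open>On the good event \<open>G\<close> the mean is at most the squared norm of
  \<open>u\<close> and the deviation at least \<open>\<tau>\<^sup>2 * sqrt (card I / 128)\<close>,
  so their ratio is at most \<open>q\<close> and the tail bound applies. Since \<open>G\<close> has
  probability at least 3/10, the factor 1/3 of that bound becomes 1/10.\<close>

lemma prob_quadratic_form_le_tail:
  assumes q: "(L2_set u I)\<^sup>2 * sqrt 128 \<le> \<tau>\<^sup>2 * sqrt (card I) * q"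
  shows "prob {\<omega> \<in> space M. 0 \<le> (\<Sum>k\<in>I. (u k + Z (1, k) \<omega>) * (u k + Z (2, k) \<omega>))}
    \<le> 1 - exp (- ((q + 1)\<^sup>2 / 2)) / 10"
proof -
  let ?S = "PiM ({1::nat} \<times> I) (\<lambda>_. borel :: real measure)"
  let ?T = "PiM ({2::nat} \<times> I) (\<lambda>_. borel :: real measure)"
  let ?X = "\<lambda>\<omega>. \<lambda>j\<in>{1} \<times> I. Z j \<omega>"
  let ?Y = "\<lambda>\<omega>. \<lambda>j\<in>{2} \<times> I. Z j \<omega>"
  let ?F = "\<lambda>\<omega>. \<Sum>k\<in>I. u k * Z (1, k) \<omega>"
  define V where "V a k = u k + a (1::nat, k)" for a k
  define Q where "Q a b \<longleftrightarrow> 0 \<le> (\<Sum>k\<in>I. V a k * (u k + b (2::nat, k)))" for a b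
  define G where "G a \<longleftrightarrow> (\<Sum>k\<in>I. V a k * u k) \<le> (L2_set u I)\<^sup>2 \<and>
    \<tau>\<^sup>2 * card I / 128 \<le> (\<Sum>k\<in>I. (V a k)\<^sup>2)" for a
  define \<eta> where "\<eta> = exp (- ((q + 1)\<^sup>2 / 2)) / 3"
  define h where "h a = 1 - \<eta> * of_bool (G a)" for a
  have \<eta>: "0 \<le> \<eta>" "\<eta> \<le> 1" unfolding \<eta>_def by (auto simp: divide_le_eq order.trans[OF _ one_le_numeral])
  have d: "0 < real (card I)" using finite_I nonempty_I by (simp add: card_gt_0_iff)
  \<comment> \<open>The sign of \<open>q\<close> is forced by the hypothesis, whose left side is
    nonnegative.\<close>
  have q0: "0 \<le> q"
  proof -
    have "0 \<le> \<tau>\<^sup>2 * sqrt (card I) * q" by (rule order_trans[OF _ q]) simp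
    moreover have "0 < \<tau>\<^sup>2 * sqrt (card I)" using d \<tau>_pos by simp
    ultimately show ?thesis by (simp only: zero_le_mult_iff) linarith
  qed
  have Vm[measurable]: "(\<lambda>a. V a k) \<in> borel_measurable ?S" if "k \<in> I" for k
  proof -
    have [measurable]: "(1, k) \<in> {1::nat} \<times> I" using that by simp
    show ?thesis unfolding V_def by measurable
  qed
  have Gm[measurable]: "Measurable.pred ?S G"
    unfolding G_def by measurable
  have hm[measurable]: "h \<in> borel_measurable ?S"
    unfolding h_def by measurable
  have Xm[measurable]: "?X \<in> measurable M ?S" "?Y \<in> measurable M ?T"
    by (auto intro!: measurable_restrict measurable_noise)
  have X1: "V (?X \<omega>) k = u k + Z (1, k) \<omega>" if "k \<in> I" for k \<omega>
    using that by (simp add: V_def)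
  have sq: "(\<Sum>k\<in>I. u k * u k) = (L2_set u I)\<^sup>2"
    by (simp add: L2_set_def sum_nonneg power2_eq_square[symmetric])
  have Zm[measurable]: "Z (1, k) \<in> borel_measurable M" if "k \<in> I" for k
    using that by (intro measurable_noise) auto
  have "prob {\<omega> \<in> space M. Q (?X \<omega>) (?Y \<omega>)} \<le> expectation (\<lambda>\<omega>. h (?X \<omega>))"
  proof (rule indep_var_prob_le[OF indep_noise_rows])
    show "Measurable.pred (?S \<Otimes>\<^sub>M ?T) (\<lambda>p. Q (fst p) (snd p))"
      unfolding Q_def V_def by measurable
    show "h \<in> borel_measurable ?S" by (rule hm)
    show "integrable M (\<lambda>\<omega>. h (?X \<omega>))"
      by (rule integrable_const_bound[where B=1, OF _ measurable_compose[OF Xm(1) hm]])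
        (use \<eta> in \<open>auto simp: h_def\<close>)
    fix a
    show "prob {\<omega> \<in> space M. Q a (?Y \<omega>)} \<le> h a"
    proof (cases "G a")
      case True
      have norm: "\<tau> * sqrt (card I) / sqrt 128 \<le> L2_set (V a) I"
      proof -
        have "sqrt (\<tau>\<^sup>2 * card I / 128) \<le> L2_set (V a) I"
          using True unfolding G_def L2_set_def by (intro real_sqrt_le_mono) simp
        then show ?thesis using \<tau>_pos by (simp add: real_sqrt_mult real_sqrt_divide)
      qed
      have "0 < \<tau> * sqrt (card I) / sqrt 128" using d \<tau>_pos by simp
      then have v: "L2_set (V a) I \<noteq> 0" using norm by linarith
      have "(\<Sum>k\<in>I. V a k * u k) \<le> (L2_set u I)\<^sup>2" using True by (simp add: G_def)
      also have "\<dots> \<le> \<tau> * (\<tau> * sqrt (card I) / sqrt 128) * q"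
        using q by (simp add: field_simps power2_eq_square)
      also have "\<dots> \<le> \<tau> * L2_set (V a) I * q"
        using norm \<tau>_pos q0 by (intro mult_right_mono mult_left_mono) auto
      finally have "prob {\<omega> \<in> space M. 0 \<le> (\<Sum>k\<in>I. V a k * (u k + Z (2, k) \<omega>))} \<le> 1 - \<eta>"
        unfolding \<eta>_def by (rule prob_correlation_le_tail[OF v _ q0])
      moreover have "{\<omega> \<in> space M. Q a (?Y \<omega>)} =
          {\<omega> \<in> space M. 0 \<le> (\<Sum>k\<in>I. V a k * (u k + Z (2, k) \<omega>))}"
        by (auto simp: Q_def cong: sum.cong)
      ultimately show ?thesis using True by (simp add: h_def)
    qed (simp add: h_def)
  qed
  also have "expectation (\<lambda>\<omega>. h (?X \<omega>)) = 1 - \<eta> * prob {\<omega> \<in> space M. G (?X \<omega>)}"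
  proof -
    have "expectation (\<lambda>\<omega>. h (?X \<omega>)) =
        expectation (\<lambda>\<omega>. 1 - \<eta> * indicator {\<omega> \<in> space M. G (?X \<omega>)} \<omega>)"
      by (intro Bochner_Integration.integral_cong) (auto simp: h_def)
    also have "\<dots> = 1 - \<eta> * prob {\<omega> \<in> space M. G (?X \<omega>)}"
      by (rule expectation_affine_indicator) measurable
    finally show ?thesis .
  qed
  also have "\<dots> \<le> 1 - \<eta> * (3 / 10)"
  proof -
    \<comment> \<open>\<open>G\<close> can fail in two ways: a positive noise contribution to the
      mean, of probability at most 1/2 by symmetry, or a small norm, of probability at most
      1/5.\<close>
    let ?B1 = "{\<omega> \<in> space M. 0 < ?F \<omega>}"
    let ?B2 = "{\<omega> \<in> space M. (\<Sum>k\<in>I. (u k + Z (1, k) \<omega>)\<^sup>2) < \<tau>\<^sup>2 * card I / 128}"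
    have "prob ?B1 \<le> 1 / 2"
    proof (cases "L2_set u I = 0")
      case True
      then have "\<forall>k\<in>I. u k = 0" using finite_I by (simp add: L2_set_eq_0_iff)
      then show ?thesis by simp
    next
      case False
      then have r: "0 < \<tau> * L2_set u I" using \<tau>_pos L2_set_nonneg[of u I] by (simp add: less_le)
      have n: "distributed M lborel ?F (normal_density 0 (\<tau> * L2_set u I))"
        by (rule distributed_noise_form[OF _ False]) simp
      have "prob ?B1 \<le> prob {\<omega> \<in> space M. - 0 \<le> ?F \<omega>}"
        using distributed_measurable[OF n] by (intro finite_measure_mono) auto
      also have "\<dots> \<le> 1 / 2" using prob_centered_normal_ge_le[OF n r, of 0] by simp
      finally show ?thesis .
    qed
    moreover have "prob ?B2 \<le> 1 / 5" by (rule prob_norm_small)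
    moreover have "prob (?B1 \<union> ?B2) \<le> prob ?B1 + prob ?B2"
      by (rule measure_Un_le) measurable
    moreover have "space M - {\<omega> \<in> space M. G (?X \<omega>)} \<subseteq> ?B1 \<union> ?B2"
    proof
      fix \<omega> assume *: "\<omega> \<in> space M - {\<omega> \<in> space M. G (?X \<omega>)}"
      have "(\<Sum>k\<in>I. V (?X \<omega>) k * u k) = (\<Sum>k\<in>I. u k * u k + u k * Z (1, k) \<omega>)"
        by (intro sum.cong) (auto simp: X1[unfolded One_nat_def] algebra_simps)
      moreover have "(\<Sum>k\<in>I. (V (?X \<omega>) k)\<^sup>2) = (\<Sum>k\<in>I. (u k + Z (1, k) \<omega>)\<^sup>2)"
        by (intro sum.cong) (auto simp: X1[unfolded One_nat_def])
      ultimately show "\<omega> \<in> ?B1 \<union> ?B2"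
        using * by (auto simp: G_def sum.distrib sq)
    qed
    then have "prob (space M - {\<omega> \<in> space M. G (?X \<omega>)}) \<le> prob (?B1 \<union> ?B2)"
      by (rule finite_measure_mono) measurable
    moreover have "prob (space M - {\<omega> \<in> space M. G (?X \<omega>)}) = 1 - prob {\<omega> \<in> space M. G (?X \<omega>)}"
      by (rule prob_compl) measurable
    ultimately have "3 / 10 \<le> prob {\<omega> \<in> space M. G (?X \<omega>)}" by linarith
    from mult_left_mono[OF this \<eta>(1)] show ?thesis by simp
  qed
  finally have "prob {\<omega> \<in> space M. Q (?X \<omega>) (?Y \<omega>)} \<le> 1 - exp (- ((q + 1)\<^sup>2 / 2)) / 10"
    by (simp add: \<eta>_def)
  moreover have "{\<omega> \<in> space M. Q (?X \<omega>) (?Y \<omega>)} =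
      {\<omega> \<in> space M. 0 \<le> (\<Sum>k\<in>I. (u k + Z (1, k) \<omega>) * (u k + Z (2, k) \<omega>))}"
    by (auto simp: Q_def X1[unfolded One_nat_def] cong: sum.cong)
  ultimately show ?thesis by simp
qed

end

text \<open>Each difference is a function of its own block \<open>{a l, b l}\<close>, and the blocks
  are disjoint.\<close>

lemma indep_vars_diff:
  fixes X :: "'j \<Rightarrow> 'a \<Rightarrow> real"
  assumes "indep_vars (\<lambda>_. borel) X J" "a ` L \<subseteq> J" "b ` L \<subseteq> J"
    and "disjoint_family_on (\<lambda>l. {a l, b l}) L"
  shows "indep_vars (\<lambda>_. borel) (\<lambda>l \<omega>. X (a l) \<omega> - X (b l) \<omega>) L"
proof -
  have "indep_vars (\<lambda>l. PiM {a l, b l} (\<lambda>_. borel)) (\<lambda>l \<omega>. \<lambda>j\<in>{a l, b l}. X j \<omega>) L"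
    by (rule indep_vars_restrict) (use assms in auto)
  then have "indep_vars (\<lambda>_. borel)
      (\<lambda>l \<omega>. (\<lambda>j\<in>{a l, b l}. X j \<omega>) (a l) - (\<lambda>j\<in>{a l, b l}. X j \<omega>) (b l)) L"
    by (rule indep_vars_compose2) measurable
  then show ?thesis by simp
qed

section \<open>Averaging over the random feature difference\<close>

context
  fixes I :: "'i set" and Z :: "nat \<times> 'i \<Rightarrow> 'a \<Rightarrow> real" and \<tau> s :: real
  assumes finite_I: "finite I" and nonempty_I: "I \<noteq> {}" and \<tau>_pos: "0 < \<tau>"
    and indep_Z: "indep_vars (\<lambda>_. borel) Z ({0, 1, 2} \<times> I)"
    and normal_Z: "\<And>j. j \<in> {1, 2} \<times> I \<Longrightarrow> distributed M lborel (Z j) (normal_density 0 \<tau>)"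
    and s_pos: "0 < s"
    and second_moment: "\<And>k. k \<in> I \<Longrightarrow> integrable M (\<lambda>\<omega>. (Z (0, k) \<omega>)\<^sup>2)"
      "(\<Sum>k\<in>I. expectation (\<lambda>\<omega>. (Z (0, k) \<omega>)\<^sup>2)) \<le> 2 * s"
begin

text \<open>Row 0, the feature difference, is frozen and the two noise rows stay random. This
  reduces the random features to the bounds for a fixed \<open>u\<close>.\<close>

lemma prob_averaged_quadratic_form_le:
  assumes h[measurable]: "h \<in> borel_measurable (PiM ({0} \<times> I) (\<lambda>_. borel :: real measure))"
    and int: "integrable M (\<lambda>\<omega>. h (\<lambda>j\<in>{0} \<times> I. Z j \<omega>))"
    and bound: "\<And>a. prob {\<omega> \<in> space M.
      0 \<le> (\<Sum>k\<in>I. (a (0, k) + Z (1, k) \<omega>) * (a (0, k) + Z (2, k) \<omega>))} \<le> h a"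
  shows "prob {\<omega> \<in> space M. 0 \<le> (\<Sum>k\<in>I. (Z (0, k) \<omega> + Z (1, k) \<omega>) * (Z (0, k) \<omega> + Z (2, k) \<omega>))}
    \<le> expectation (\<lambda>\<omega>. h (\<lambda>j\<in>{0} \<times> I. Z j \<omega>))"
proof -
  let ?S = "PiM ({0::nat} \<times> I) (\<lambda>_. borel :: real measure)"
  let ?T = "PiM ({1::nat, 2} \<times> I) (\<lambda>_. borel :: real measure)"
  let ?X = "\<lambda>\<omega>. \<lambda>j\<in>{0} \<times> I. Z j \<omega>"
  let ?Y = "\<lambda>\<omega>. \<lambda>j\<in>{1, 2} \<times> I. Z j \<omega>"
  define Q where "Q a b \<longleftrightarrow> 0 \<le> (\<Sum>k\<in>I. (a (0::nat, k) + b (1::nat, k)) * (a (0, k) + b (2, k)))"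
    for a b :: "nat \<times> 'i \<Rightarrow> real"
  have "prob {\<omega> \<in> space M. Q (?X \<omega>) (?Y \<omega>)} \<le> expectation (\<lambda>\<omega>. h (?X \<omega>))"
  proof (rule indep_var_prob_le[where S="?S" and T="?T" and X="?X" and Y="?Y" and Q=Q and h=h])
    show "h \<in> borel_measurable ?S" "integrable M (\<lambda>\<omega>. h (?X \<omega>))" by (fact h, fact int)
    show "indep_var ?S ?X ?T ?Y"
      by (rule indep_var_restrict[OF indep_Z]) auto
    have [measurable]: "(\<lambda>p. fst p (0, k)) \<in> borel_measurable (?S \<Otimes>\<^sub>M ?T)"
      "(\<lambda>p. snd p (1, k)) \<in> borel_measurable (?S \<Otimes>\<^sub>M ?T)"
      "(\<lambda>p. snd p (2, k)) \<in> borel_measurable (?S \<Otimes>\<^sub>M ?T)" if "k \<in> I" for k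
      using that by (auto intro!: measurable_compose[OF measurable_fst]
          measurable_compose[OF measurable_snd] measurable_component_singleton)
    show "Measurable.pred (?S \<Otimes>\<^sub>M ?T) (\<lambda>p. Q (fst p) (snd p))"
      unfolding Q_def by measurable
    fix a
    have "{\<omega> \<in> space M. Q a (?Y \<omega>)} = {\<omega> \<in> space M.
      0 \<le> (\<Sum>k\<in>I. (a (0, k) + Z (1, k) \<omega>) * (a (0, k) + Z (2, k) \<omega>))}"
      unfolding Q_def by (intro Collect_cong conj_cong refl arg_cong[where f="\<lambda>t. 0 \<le> t"] sum.cong) auto
    then show "prob {\<omega> \<in> space M. Q a (?Y \<omega>)} \<le> h a" using bound by simp
  qed
  also have "{\<omega> \<in> space M. Q (?X \<omega>) (?Y \<omega>)} = {\<omega> \<in> space M.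
      0 \<le> (\<Sum>k\<in>I. (Z (0, k) \<omega> + Z (1, k) \<omega>) * (Z (0, k) \<omega> + Z (2, k) \<omega>))}"
    unfolding Q_def by (intro Collect_cong conj_cong refl arg_cong[where f="\<lambda>t. 0 \<le> t"] sum.cong) auto
  finally show ?thesis .
qed

lemma indep_noise: "indep_vars (\<lambda>_. borel) Z ({1, 2} \<times> I)"
  by (rule indep_vars_subset[OF indep_Z]) auto

lemma measurable_square_norm:
  "(\<lambda>a. \<Sum>k\<in>I. (a (0, k))\<^sup>2) \<in> borel_measurable (PiM ({0::nat} \<times> I) (\<lambda>_. borel :: real measure))"
proof -
  have [measurable]: "(\<lambda>a. a (0, k)) \<in> borel_measurable (PiM ({0::nat} \<times> I) (\<lambda>_. borel :: real measure))"
    if "k \<in> I" for k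
    using that by (intro measurable_component_singleton) auto
  show ?thesis by measurable
qed

lemma square_norm_restrict:
  "(\<Sum>k\<in>I. ((\<lambda>j\<in>{0} \<times> I. Z j \<omega>) (0, k))\<^sup>2) = (\<Sum>k\<in>I. (Z (0, k) \<omega>)\<^sup>2)"
  by (intro sum.cong) auto

lemma expectation_square_norm:
  "integrable M (\<lambda>\<omega>. \<Sum>k\<in>I. (Z (0, k) \<omega>)\<^sup>2)" "expectation (\<lambda>\<omega>. \<Sum>k\<in>I. (Z (0, k) \<omega>)\<^sup>2) \<le> 2 * s"
  using second_moment by (auto simp: Bochner_Integration.integral_sum)

text \<open>The bound for a fixed \<open>u\<close> is linear plus quadratic in \<open>r\<close>, the
  norm of \<open>u\<close> over \<open>\<tau>\<close>, but only the second moment of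
  \<open>r\<close> is controlled, by \<open>w\<^sup>2\<close>. The linear term is therefore replaced
  using \<open>r \<le> (w + r\<^sup>2 / w) / 2\<close>. Equality holds at \<open>r = w\<close>, so
  the averaged bound has the same form in \<open>w\<close> with no loss in the constants.\<close>

lemma prob_swap_fails_le:
  assumes w: "w = sqrt (2 * s) / \<tau>"
  shows "prob {\<omega> \<in> space M. 0 \<le> (\<Sum>k\<in>I. (Z (0, k) \<omega> + Z (1, k) \<omega>) * (Z (0, k) \<omega> + Z (2, k) \<omega>))}
    \<le> 1 / 2 + w / 5 + 4 / 25 * w\<^sup>2"
proof -
  define N where "N \<omega> = (\<Sum>k\<in>I. (Z (0, k) \<omega>)\<^sup>2)" for \<omega>
  \<comment> \<open>The coefficient of the squared norm once \<open>r / 5\<close> is replaced by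
    \<open>w / 10 + r\<^sup>2 / (10 * w)\<close>.\<close>
  define c where "c = (1 / (10 * w) + 4 / 25) / \<tau>\<^sup>2"
  define h where "h a = (1 / 2 + w / 10) + c * (\<Sum>k\<in>I. (a (0::nat, k))\<^sup>2)" for a :: "nat \<times> 'i \<Rightarrow> real"
  have w0: "0 < w" "w\<^sup>2 * \<tau>\<^sup>2 = 2 * s" using w s_pos \<tau>_pos by (auto simp: power_divide)
  have c0: "0 \<le> c" using w0 by (simp add: c_def)
  have hN: "h (\<lambda>j\<in>{0} \<times> I. Z j \<omega>) = (1 / 2 + w / 10) + c * N \<omega>" for \<omega>
    unfolding h_def N_def square_norm_restrict ..
  have intN: "integrable M N" "expectation N \<le> 2 * s"
    using expectation_square_norm unfolding N_def by auto
  have "prob {\<omega> \<in> space M. 0 \<le> (\<Sum>k\<in>I. (Z (0, k) \<omega> + Z (1, k) \<omega>) * (Z (0, k) \<omega> + Z (2, k) \<omega>))}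
    \<le> expectation (\<lambda>\<omega>. h (\<lambda>j\<in>{0} \<times> I. Z j \<omega>))"
  proof (rule prob_averaged_quadratic_form_le)
    show "h \<in> borel_measurable (PiM ({0} \<times> I) (\<lambda>_. borel))"
      unfolding h_def using measurable_square_norm by measurable
    show "integrable M (\<lambda>\<omega>. h (\<lambda>j\<in>{0} \<times> I. Z j \<omega>))"
      unfolding hN using intN by simp
    fix a :: "nat \<times> 'i \<Rightarrow> real"
    define r where "r = L2_set (\<lambda>k. a (0, k)) I / \<tau>"
    have r2: "(\<Sum>k\<in>I. (a (0, k))\<^sup>2) = r\<^sup>2 * \<tau>\<^sup>2"
      using \<tau>_pos by (simp add: r_def power_divide L2_set_def sum_nonneg)
    have c: "c * (r\<^sup>2 * \<tau>\<^sup>2) = r\<^sup>2 / (10 * w) + 4 / 25 * r\<^sup>2"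
    proof -
      have "c * (r\<^sup>2 * \<tau>\<^sup>2) = (1 / (10 * w) + 4 / 25) * r\<^sup>2"
        using \<tau>_pos by (simp add: c_def)
      then show ?thesis by (simp add: ring_distribs)
    qed
    have "2 * (w * r) \<le> w\<^sup>2 + r\<^sup>2" using zero_le_power2[of "w - r"] by (simp add: power2_diff)
    then have "r / 5 \<le> w / 10 + r\<^sup>2 / (10 * w)" using w0 by (simp add: field_simps power2_eq_square)
    then have "1 / 2 + r / 5 + 4 / 25 * r\<^sup>2 \<le> h a"
      using c by (simp add: h_def r2 algebra_simps)
    then show "prob {\<omega> \<in> space M. 0 \<le> (\<Sum>k\<in>I. (a (0, k) + Z (1, k) \<omega>) * (a (0, k) + Z (2, k) \<omega>))} \<le> h a"
      by (intro order_trans[OF prob_quadratic_form_le[OF finite_I nonempty_I \<tau>_pos indep_noise _ r_def]] normal_Z)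
  qed
  also have "\<dots> = (1 / 2 + w / 10) + c * expectation N"
    unfolding hN using intN by (simp add: prob_space)
  also have "\<dots> \<le> (1 / 2 + w / 10) + c * (2 * s)"
    using intN c0 by (intro add_left_mono mult_left_mono)
  also have "c * (2 * s) = (1 / (10 * w) + 4 / 25) * w\<^sup>2"
    unfolding c_def w0(2)[symmetric] using \<tau>_pos by simp
  also have "(1 / 2 + w / 10) + (1 / (10 * w) + 4 / 25) * w\<^sup>2 = 1 / 2 + w / 5 + 4 / 25 * w\<^sup>2"
    using w0(1) by (simp add: field_simps power2_eq_square)
  finally show ?thesis .
qed

text \<open>The squared norm of the feature difference has mean at most \<open>2 * s\<close>, so by
  Markov it is at most \<open>16 * s\<close> with probability at least 7/8. On that event the tail
  bound for a fixed \<open>u\<close> applies, and otherwise the trivial bound 1.\<close>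

lemma prob_swap_fails_le_tail:
  assumes q: "16 * s * sqrt 128 \<le> \<tau>\<^sup>2 * sqrt (card I) * q"
  shows "prob {\<omega> \<in> space M. 0 \<le> (\<Sum>k\<in>I. (Z (0, k) \<omega> + Z (1, k) \<omega>) * (Z (0, k) \<omega> + Z (2, k) \<omega>))}
    \<le> 1 - exp (- ((q + 1)\<^sup>2 / 2)) / 12"
proof -
  define N where "N \<omega> = (\<Sum>k\<in>I. (Z (0, k) \<omega>)\<^sup>2)" for \<omega>
  define \<eta> where "\<eta> = exp (- ((q + 1)\<^sup>2 / 2)) / 10"
  define h where "h a = 1 - \<eta> * of_bool ((\<Sum>k\<in>I. (a (0::nat, k))\<^sup>2) \<le> 16 * s)" for a :: "nat \<times> 'i \<Rightarrow> real"
  have \<eta>: "0 \<le> \<eta>" unfolding \<eta>_def by simp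
  have hN: "h (\<lambda>j\<in>{0} \<times> I. Z j \<omega>) = 1 - \<eta> * of_bool (N \<omega> \<le> 16 * s)" for \<omega>
    unfolding h_def N_def square_norm_restrict ..
  have intN: "integrable M N" "expectation N \<le> 2 * s"
    using expectation_square_norm unfolding N_def by auto
  then have Nm[measurable]: "N \<in> borel_measurable M" by auto
  let ?B = "{\<omega> \<in> space M. N \<omega> \<le> 16 * s}"
  have B: "?B \<in> events" by measurable
  have eqB: "(\<lambda>\<omega>. h (\<lambda>j\<in>{0} \<times> I. Z j \<omega>)) \<omega> = 1 - \<eta> * indicator ?B \<omega>" if "\<omega> \<in> space M" for \<omega>
    using that by (simp add: hN)
  have "prob {\<omega> \<in> space M. 0 \<le> (\<Sum>k\<in>I. (Z (0, k) \<omega> + Z (1, k) \<omega>) * (Z (0, k) \<omega> + Z (2, k) \<omega>))}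
    \<le> expectation (\<lambda>\<omega>. h (\<lambda>j\<in>{0} \<times> I. Z j \<omega>))"
  proof (rule prob_averaged_quadratic_form_le)
    show "h \<in> borel_measurable (PiM ({0} \<times> I) (\<lambda>_. borel))"
      unfolding h_def using measurable_square_norm by measurable
    have "integrable M (\<lambda>\<omega>. 1 - \<eta> * indicator ?B \<omega>)"
      using B by (intro Bochner_Integration.integrable_diff integrable_mult_right integrable_real_indicator)
        (auto simp: emeasure_eq_measure)
    then show "integrable M (\<lambda>\<omega>. h (\<lambda>j\<in>{0} \<times> I. Z j \<omega>))"
      by (rule Bochner_Integration.integrable_cong[THEN iffD2, rotated -1]) (use eqB in auto)
    fix a :: "nat \<times> 'i \<Rightarrow> real"
    let ?E = "{\<omega> \<in> space M. 0 \<le> (\<Sum>k\<in>I. (a (0, k) + Z (1, k) \<omega>) * (a (0, k) + Z (2, k) \<omega>))}"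
    show "prob ?E \<le> h a"
    proof (cases "(\<Sum>k\<in>I. (a (0, k))\<^sup>2) \<le> 16 * s")
      case True
      have "(L2_set (\<lambda>k. a (0, k)) I)\<^sup>2 * sqrt 128 \<le> 16 * s * sqrt 128"
        using True by (intro mult_right_mono) (auto simp: L2_set_def sum_nonneg)
      also note q
      finally have "prob ?E \<le> 1 - \<eta>"
        unfolding \<eta>_def by (intro prob_quadratic_form_le_tail[OF finite_I nonempty_I \<tau>_pos indep_noise] normal_Z)
      then show ?thesis using True by (simp add: h_def)
    qed (simp add: h_def)
  qed
  also have "\<dots> = expectation (\<lambda>\<omega>. 1 - \<eta> * indicator ?B \<omega>)"
    by (intro Bochner_Integration.integral_cong) (use eqB in auto)
  also have "\<dots> = 1 - \<eta> * prob ?B"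
    by (rule expectation_affine_indicator[OF B])
  also have "\<dots> \<le> 1 - \<eta> * (7 / 8)"
  proof -
    have "prob {\<omega> \<in> space M. 16 * s \<le> N \<omega>} \<le> expectation N / (16 * s)"
      by (rule integral_Markov_inequality_measure[OF intN(1), of "{}"])
        (use s_pos in \<open>auto simp: N_def sum_nonneg\<close>)
    also have "\<dots> \<le> 2 * s / (16 * s)" using intN s_pos by (intro divide_right_mono) auto
    also have "\<dots> = 1 / 8" using s_pos by simp
    finally have "prob {\<omega> \<in> space M. 16 * s \<le> N \<omega>} \<le> 1 / 8" .
    moreover have "prob (space M - ?B) \<le> prob {\<omega> \<in> space M. 16 * s \<le> N \<omega>}"
      by (intro finite_measure_mono) auto
    moreover have "prob (space M - ?B) = 1 - prob ?B" by (rule prob_compl[OF B])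
    ultimately have "7 / 8 \<le> prob ?B" by linarith
    from mult_left_mono[OF this \<eta>] show ?thesis by simp
  qed
  \<comment> \<open>Here \<open>1 / 10 * (7 / 8) = 7 / 80\<close> is rounded down to
    \<open>1 / 12\<close>.\<close>
  also have "\<dots> \<le> 1 - exp (- ((q + 1)\<^sup>2 / 2)) / 12"
    by (simp add: \<eta>_def)
  finally show ?thesis .
qed

end
end

subsection \<open>Reduction to disjoint pairs of vertices\<close>

text \<open>Only the summands at \<open>i\<close> and \<open>j\<close> change. In their difference
  all squares cancel and the mixed products combine into one inner product.\<close>

lemma matching_cost_swap:
  assumes "i \<in> {1..n}" "j \<in> {1..n}" "i \<noteq> j"
  shows "matching_cost n d Y Y' (\<pi> \<circ> Transposition.transpose i j) - matching_cost n d Y Y' \<pi> =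
    2 * (\<Sum>k=1..d. (Y i k - Y j k) * (Y' (\<pi> i) k - Y' (\<pi> j) k))"
proof -
  define c where "c a b = (\<Sum>k=1..d. (Y a k - Y' b k)\<^sup>2)" for a b
  have cost: "matching_cost n d Y Y' \<rho> = (\<Sum>a=1..n. c a (\<rho> a))" for \<rho>
    by (simp add: matching_cost_def L2_set_def sum_nonneg c_def)
  have split: "(\<Sum>a=1..n. f a) = f i + f j + (\<Sum>a\<in>{1..n} - {i, j}. f a)" for f :: "nat \<Rightarrow> real"
    using assms by (subst sum.subset_diff[of "{i, j}"]) auto
  have "matching_cost n d Y Y' (\<pi> \<circ> Transposition.transpose i j) - matching_cost n d Y Y' \<pi> =
      c i (\<pi> j) + c j (\<pi> i) - c i (\<pi> i) - c j (\<pi> j)"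
  proof -
    have "(\<Sum>a\<in>{1..n} - {i, j}. c a ((\<pi> \<circ> Transposition.transpose i j) a)) =
        (\<Sum>a\<in>{1..n} - {i, j}. c a (\<pi> a))"
      by (intro sum.cong) (auto simp: transpose_def)
    then show ?thesis unfolding cost split by simp
  qed
  also have "\<dots> = (\<Sum>k=1..d. 2 * ((Y i k - Y j k) * (Y' (\<pi> i) k - Y' (\<pi> j) k)))"
    unfolding c_def sum.distrib[symmetric] sum_subtractf[symmetric]
    by (intro sum.cong) (auto simp: power2_eq_square algebra_simps)
  finally show ?thesis by (simp add: sum_distrib_left)
qed

text \<open>A minimizer cannot be improved by a transposition. Only minimality enters, so it does
  not matter which minimizer is selected in case of a tie.\<close>

lemma linear_matching_correlation_nonneg:
  assumes "linear_matching n d Y Y' = \<pi>" "\<pi> permutes {1..n}"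
    and ij: "i \<in> {1..n}" "j \<in> {1..n}" "i \<noteq> j"
  shows "0 \<le> (\<Sum>k=1..d. (Y i k - Y j k) * (Y' (\<pi> i) k - Y' (\<pi> j) k))"
proof -
  let ?P = "{\<rho>. \<rho> permutes {1..n}}"
  have "\<pi> \<circ> Transposition.transpose i j permutes {1..n}"
    using assms by (intro permutes_compose permutes_swap_id)
  then have "matching_cost n d Y Y' (arg_min_on (matching_cost n d Y Y') ?P)
      \<le> matching_cost n d Y Y' (\<pi> \<circ> Transposition.transpose i j)"
    using assms(2) by (intro arg_min_least[of ?P _ "matching_cost n d Y Y'"]) (auto simp: finite_permutations)
  also have "arg_min_on (matching_cost n d Y Y') ?P = \<pi>"
    using assms(1) by (simp add: linear_matching_def arg_min_on_def)
  finally show ?thesis using matching_cost_swap[OF ij, of d Y Y' \<pi>] by linarith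
qed

lemma (in prob_space) indep_vars_imp_indep_var:
  assumes "indep_vars (\<lambda>_. N) X J" "a \<in> J" "b \<in> J" "a \<noteq> b"
  shows "indep_var N (X a) N (X b)"
proof -
  have "indep_var (PiM {a} (\<lambda>_. N)) (\<lambda>\<omega>. \<lambda>j\<in>{a}. X j \<omega>) (PiM {b} (\<lambda>_. N)) (\<lambda>\<omega>. \<lambda>j\<in>{b}. X j \<omega>)"
    by (rule indep_var_restrict[OF assms(1)]) (use assms in auto)
  then have "indep_var N ((\<lambda>p. p a) \<circ> (\<lambda>\<omega>. \<lambda>j\<in>{a}. X j \<omega>)) N ((\<lambda>p. p b) \<circ> (\<lambda>\<omega>. \<lambda>j\<in>{b}. X j \<omega>))"
    by (rule indep_var_compose) measurable
  then show ?thesis by (simp add: comp_def)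
qed

text \<open>Translates a vertex \<open>i\<close> and a pair (row, coordinate) into the nested sum
  that indexes the independent family: row 0 is the feature, row 1 the noise of \<open>y\<close>,
  row 2 the noise of \<open>y'\<close>. The last is attached to \<open>\<pi> i\<close>, the label
  under which the feature of \<open>i\<close> reappears in \<open>y'\<close>.\<close>

definition model_index :: "(nat \<Rightarrow> nat) \<Rightarrow> nat \<Rightarrow> nat \<times> nat \<Rightarrow> nat \<times> nat + nat \<times> nat + nat \<times> nat" where
  "model_index \<pi> i = (\<lambda>(t, k). if t = 0 then Inl (i, k) else if t = 1 then Inr (Inl (i, k)) else Inr (Inr (\<pi> i, k)))"

lemma model_index_eq_iff:
  assumes "inj \<pi>" "fst p \<in> {0, 1, 2}" "fst q \<in> {0, 1, 2}"
  shows "model_index \<pi> i p = model_index \<pi> j q \<longleftrightarrow> i = j \<and> p = q"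
  using assms by (cases p; cases q) (auto simp: model_index_def inj_eq)

section \<open>Pair differences in the feature model\<close>

context feature_model
begin

lemma d_pos: "0 < d"
  using s_pos s_le by (auto intro: ccontr)

lemma feature_moments:
  assumes "i \<in> {1..n}" "k \<in> {1..d}"
  shows "integrable M (\<lambda>\<omega>. (x i k \<omega>)\<^sup>2)" "expectation (\<lambda>\<omega>. (x i k \<omega>)\<^sup>2) = s / d"
    "AE \<omega> in M. 0 \<le> x i k \<omega>"
proof -
  note [measurable] = measurable_entries(1)[OF assms]
  let ?B = "bernoulli_pmf (s / real d)"
  have eq: "distr M borel (x i k) = distr ?B borel of_bool"
    by (rule bernoulli_entries[OF assms])
  have "integrable (distr ?B borel of_bool) (\<lambda>t::real. t\<^sup>2)"
    by (subst integrable_distr_eq) (auto intro: integrable_measure_pmf_finite)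
  then show "integrable M (\<lambda>\<omega>. (x i k \<omega>)\<^sup>2)"
    unfolding eq[symmetric] by (subst (asm) integrable_distr_eq) auto
  have "expectation (\<lambda>\<omega>. (x i k \<omega>)\<^sup>2) = (\<integral>t. t\<^sup>2 \<partial>distr ?B borel of_bool)"
    unfolding eq[symmetric] by (subst integral_distr) auto
  also have "\<dots> = (\<integral>b. (of_bool b)\<^sup>2 \<partial>?B)"
    by (subst integral_distr) auto
  also have "\<dots> = s / d"
    using s_pos s_le d_pos by (subst integral_bernoulli_pmf) auto
  finally show "expectation (\<lambda>\<omega>. (x i k \<omega>)\<^sup>2) = s / d" .
  have "AE t in distr ?B borel of_bool. (0::real) \<le> t"
    by (subst AE_distr_iff) auto
  then show "AE \<omega> in M. 0 \<le> x i k \<omega>"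
    unfolding eq[symmetric] by (subst (asm) AE_distr_iff) auto
qed

text \<open>The features are almost surely nonnegative, so the cross term of the square is at most 0
  and the two second moments \<open>s / d\<close> add up.\<close>

lemma feature_difference_moment:
  assumes "i \<in> {1..n}" "j \<in> {1..n}" "k \<in> {1..d}"
  shows "integrable M (\<lambda>\<omega>. (x i k \<omega> - x j k \<omega>)\<^sup>2)"
    "expectation (\<lambda>\<omega>. (x i k \<omega> - x j k \<omega>)\<^sup>2) \<le> 2 * s / d"
proof -
  note [measurable] = measurable_entries(1)[OF assms(1,3)] measurable_entries(1)[OF assms(2,3)]
  note xi = feature_moments[OF assms(1,3)] and xj = feature_moments[OF assms(2,3)]
  have int: "integrable M (\<lambda>\<omega>. (x i k \<omega>)\<^sup>2 + (x j k \<omega>)\<^sup>2)" using xi(1) xj(1) by simp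
  have AE: "AE \<omega> in M. (x i k \<omega> - x j k \<omega>)\<^sup>2 \<le> (x i k \<omega>)\<^sup>2 + (x j k \<omega>)\<^sup>2"
    using xi(3) xj(3) by eventually_elim (simp add: power2_diff)
  show 1: "integrable M (\<lambda>\<omega>. (x i k \<omega> - x j k \<omega>)\<^sup>2)"
    by (rule Bochner_Integration.integrable_bound[OF int]) (use AE in auto)
  have "expectation (\<lambda>\<omega>. (x i k \<omega> - x j k \<omega>)\<^sup>2) \<le> expectation (\<lambda>\<omega>. (x i k \<omega>)\<^sup>2 + (x j k \<omega>)\<^sup>2)"
    by (rule integral_mono_AE[OF 1 int AE])
  also have "\<dots> = 2 * s / d" using xi xj by simp
  finally show "expectation (\<lambda>\<omega>. (x i k \<omega> - x j k \<omega>)\<^sup>2) \<le> 2 * s / d" .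
qed


abbreviation "entry \<equiv> case_sum (\<lambda>(i, k). x i k) (case_sum (\<lambda>(i, k). \<epsilon> i k) (\<lambda>(i, k). \<epsilon>' i k))"

text \<open>The index is \<open>(l, t, k)\<close>: the pair \<open>(2 * l + 1, 2 * l + 2)\<close>,
  the row \<open>t\<close> and the coordinate \<open>k\<close>. One family over all pairs serves
  both for independence between pairs and for independence within a pair.\<close>

definition pair_diff :: "nat \<times> nat \<times> nat \<Rightarrow> 'a \<Rightarrow> real" where
  "pair_diff = (\<lambda>(l, p) \<omega>. entry (model_index pistar (2 * l + 1) p) \<omega> - entry (model_index pistar (2 * l + 2) p) \<omega>)"

lemma pair_diff_simps:
  "pair_diff (l, 0, k) \<omega> = x (2 * l + 1) k \<omega> - x (2 * l + 2) k \<omega>"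
  "pair_diff (l, 1, k) \<omega> = \<epsilon> (2 * l + 1) k \<omega> - \<epsilon> (2 * l + 2) k \<omega>"
  "pair_diff (l, 2, k) \<omega> = \<epsilon>' (pistar (2 * l + 1)) k \<omega> - \<epsilon>' (pistar (2 * l + 2)) k \<omega>"
  by (simp_all add: pair_diff_def model_index_def)

lemma inj_pistar: "inj pistar"
  by (rule permutes_inj[OF pistar])

lemma model_index_in:
  "i \<in> {1..n} \<Longrightarrow> p \<in> {0, 1, 2} \<times> {1..d} \<Longrightarrow>
    model_index pistar i p \<in> ({1..n} \<times> {1..d}) <+> (({1..n} \<times> {1..d}) <+> ({1..n} \<times> {1..d}))"
  using permutes_in_image[OF pistar, of i] by (auto simp: model_index_def)

lemma pair_indices: "l < n div 2 \<Longrightarrow> 2 * l + 1 \<in> {1..n}" "l < n div 2 \<Longrightarrow> 2 * l + 2 \<in> {1..n}"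
  by auto

lemma indep_pair_diff:
  "indep_vars (\<lambda>_. borel) pair_diff ({..<n div 2} \<times> {0, 1, 2} \<times> {1..d})"
proof -
  let ?a = "\<lambda>q. model_index pistar (2 * fst q + 1) (snd q)"
  let ?b = "\<lambda>q. model_index pistar (2 * fst q + 2) (snd q)"
  let ?L = "{..<n div 2} \<times> {0::nat, 1, 2} \<times> {1..d}"
  have "indep_vars (\<lambda>_. borel) (\<lambda>q \<omega>. entry (?a q) \<omega> - entry (?b q) \<omega>) ?L"
  proof (rule indep_vars_diff[OF independent])
    show "?a ` ?L \<subseteq> ({1..n} \<times> {1..d}) <+> (({1..n} \<times> {1..d}) <+> ({1..n} \<times> {1..d}))"
      "?b ` ?L \<subseteq> ({1..n} \<times> {1..d}) <+> (({1..n} \<times> {1..d}) <+> ({1..n} \<times> {1..d}))"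
      by (intro image_subsetI model_index_in pair_indices; simp add: mem_Times_iff)+
    show "disjoint_family_on (\<lambda>q. {?a q, ?b q}) ?L"
      unfolding disjoint_family_on_def
    proof (intro ballI impI)
      fix q r assume qr: "q \<in> ?L" "r \<in> ?L" "q \<noteq> r"
      have "fst (snd q) \<in> {0, 1, 2}" "fst (snd r) \<in> {0, 1, 2}" using qr by auto
      note eq = model_index_eq_iff[OF inj_pistar this]
      \<comment> \<open>By parity a first vertex of one pair is never a second vertex of another.
        Two first or two second vertices can share an index only if pair, row and coordinate all
        agree.\<close>
      have "2 * fst q + 1 \<noteq> 2 * fst r + 2" "2 * fst q + 2 \<noteq> 2 * fst r + 1" by presburger+
      moreover have "\<not> (fst q = fst r \<and> snd q = snd r)" using qr(3) by (simp add: prod_eq_iff)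
      ultimately show "{?a q, ?b q} \<inter> {?a r, ?b r} = {}" by (simp add: eq)
    qed
  qed
  then show ?thesis by (simp add: pair_diff_def case_prod_beta')
qed

lemma indep_single_pair_diff:
  assumes "l < n div 2"
  shows "indep_vars (\<lambda>_. borel) (\<lambda>p. pair_diff (l, p)) ({0, 1, 2} \<times> {1..d})"
  by (rule indep_vars_reindex_const, simp add: inj_on_def, rule indep_vars_subset[OF indep_pair_diff])
    (use assms in auto)

lemma normal_pair_diff:
  assumes l: "l < n div 2" and p: "p \<in> {1, 2} \<times> {1..d}"
  shows "distributed M lborel (pair_diff (l, p)) (normal_density 0 (sqrt 2 * \<sigma>))"
proof -
  let ?a = "model_index pistar (2 * l + 1) p" and ?b = "model_index pistar (2 * l + 2) p"
  have p': "p \<in> {0, 1, 2} \<times> {1..d}" using p by auto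
  then have "fst p \<in> {0, 1, 2}" by auto
  then have "?a \<noteq> ?b" by (simp add: model_index_eq_iff[OF inj_pistar])
  then have ind: "indep_var borel (entry ?a) borel (entry ?b)"
    using model_index_in[OF pair_indices(1)[OF l] p'] model_index_in[OF pair_indices(2)[OF l] p']
    by (intro indep_vars_imp_indep_var[OF independent])
  have pistar_in: "pistar i \<in> {1..n}" if "i \<in> {1..n}" for i
    using permutes_in_image[OF pistar] that by simp
  have normal: "distributed M lborel (entry (model_index pistar i p)) (normal_density 0 \<sigma>)"
    if "i \<in> {1..n}" for i
  proof -
    obtain t k where tk: "p = (t, k)" "t = 1 \<or> t = 2" "k \<in> {1..d}" using p by (cases p) auto
    then show ?thesis
      using normal_noise[OF that tk(3)] normal_noise'[OF pistar_in[OF that] tk(3)]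
      by (elim disjE) (simp_all add: model_index_def)
  qed
  have "distributed M lborel (\<lambda>\<omega>. entry ?a \<omega> - entry ?b \<omega>) (normal_density (0 - 0) (sqrt (\<sigma>\<^sup>2 + \<sigma>\<^sup>2)))"
    by (rule diff_indep_normal[OF ind sigma_pos sigma_pos normal normal]) (use pair_indices[OF l] in auto)
  moreover have "sqrt (\<sigma>\<^sup>2 + \<sigma>\<^sup>2) = sqrt 2 * \<sigma>"
    using sigma_pos by (simp add: real_sqrt_mult)
  ultimately show ?thesis by (simp add: pair_diff_def)
qed

text \<open>Rows 0 and 1 add up to the difference of the two \<open>y\<close>, rows 0 and 2 to that
  of the matched \<open>y'\<close>. The event thus says that transposing the pair fails to lower the
  cost of \<open>pistar\<close>.\<close>

definition swap_fails :: "nat \<Rightarrow> 'a set" where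
  "swap_fails l = {\<omega> \<in> space M. 0 \<le> (\<Sum>k=1..d. (pair_diff (l, 0, k) \<omega> + pair_diff (l, 1, k) \<omega>) *
    (pair_diff (l, 0, k) \<omega> + pair_diff (l, 2, k) \<omega>))}"

lemma recovery_subset_swap_fails:
  assumes l: "l < n div 2"
  shows "recovery_event M n d pistar y y' \<subseteq> swap_fails l"
proof
  fix \<omega> assume "\<omega> \<in> recovery_event M n d pistar y y'"
  then have \<omega>: "\<omega> \<in> space M"
    and lm: "linear_matching n d (\<lambda>i k. y i k \<omega>) (\<lambda>i k. y' i k \<omega>) = pistar"
    by (auto simp: recovery_event_def)
  note ij = pair_indices[OF l]
  have "0 \<le> (\<Sum>k=1..d. (y (2 * l + 1) k \<omega> - y (2 * l + 2) k \<omega>) *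
      (y' (pistar (2 * l + 1)) k \<omega> - y' (pistar (2 * l + 2)) k \<omega>))"
    by (rule linear_matching_correlation_nonneg[OF lm pistar ij]) simp
  also have "\<dots> = (\<Sum>k=1..d. (pair_diff (l, 0, k) \<omega> + pair_diff (l, 1, k) \<omega>) *
    (pair_diff (l, 0, k) \<omega> + pair_diff (l, 2, k) \<omega>))"
  proof (rule sum.cong[OF refl])
    fix k assume k: "k \<in> {1..d}"
    show "(y (2 * l + 1) k \<omega> - y (2 * l + 2) k \<omega>) *
        (y' (pistar (2 * l + 1)) k \<omega> - y' (pistar (2 * l + 2)) k \<omega>) =
      (pair_diff (l, 0, k) \<omega> + pair_diff (l, 1, k) \<omega>) * (pair_diff (l, 0, k) \<omega> + pair_diff (l, 2, k) \<omega>)"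
      unfolding pair_diff_simps observed[OF ij(1) k \<omega>] observed[OF ij(2) k \<omega>]
        observed'[OF ij(1) k \<omega>] observed'[OF ij(2) k \<omega>]
      by (rule arg_cong2[where f="(*)"]) simp_all
  qed
  finally show "\<omega> \<in> swap_fails l" using \<omega> by (simp add: swap_fails_def)
qed

text \<open>Recovery lies in every \<open>swap_fails l\<close>. Each of these depends only on the
  block of \<open>pair_diff\<close> belonging to \<open>l\<close>; the blocks are independent, so
  the intersection has the product probability.\<close>

lemma recovery_prob_le_power:
  assumes p: "\<And>l. l < n div 2 \<Longrightarrow> prob (swap_fails l) \<le> p" and n: "2 \<le> n"
  shows "recovery_prob M n d pistar y y' \<le> p ^ (n div 2)"
proof -
  let ?m = "n div 2"
  let ?P = "{0::nat, 1, 2} \<times> {1..d}"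
  let ?K = "\<lambda>l. {l} \<times> ?P"
  let ?X = "\<lambda>l \<omega>. \<lambda>q\<in>?K l. pair_diff q \<omega>"
  define g where "g l q = (\<Sum>k=1..d. (q (l::nat, 0::nat, k::nat) + q (l, 1, k)) * (q (l, 0, k) + q (l, 2, k)))"
    for l and q :: "nat \<times> nat \<times> nat \<Rightarrow> real"
  \<comment> \<open>The product rule and the measurability of the intersection are applied to a
    nonempty set of pairs.\<close>
  have m: "?m \<noteq> 0" using n by linarith
  have "indep_vars (\<lambda>l. PiM (?K l) (\<lambda>_. borel)) ?X {..<?m}"
    by (rule indep_vars_restrict[OF indep_pair_diff]) (auto simp: disjoint_family_on_def)
  then have ind: "indep_vars (\<lambda>_. borel) (\<lambda>l \<omega>. g l (?X l \<omega>)) {..<?m}"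
  proof (rule indep_vars_compose2)
    fix l :: nat
    have [measurable]: "(\<lambda>q. q (l, t, k)) \<in> borel_measurable (PiM (?K l) (\<lambda>_. borel :: real measure))"
      if "t \<in> {0, 1, 2}" "k \<in> {1..d}" for t k
      using that by (intro measurable_component_singleton) auto
    show "g l \<in> borel_measurable (PiM (?K l) (\<lambda>_. borel))"
      unfolding g_def by measurable
  qed
  have eq: "(\<lambda>\<omega>. g l (?X l \<omega>)) -` {0..} \<inter> space M = swap_fails l" for l
  proof -
    have "g l (?X l \<omega>) = (\<Sum>k=1..d. (pair_diff (l, 0, k) \<omega> + pair_diff (l, 1, k) \<omega>) *
        (pair_diff (l, 0, k) \<omega> + pair_diff (l, 2, k) \<omega>))" for \<omega>
      unfolding g_def by (intro sum.cong refl) simp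
    then show ?thesis by (auto simp: swap_fails_def)
  qed
  have "recovery_prob M n d pistar y y' \<le> prob (\<Inter>l\<in>{..<?m}. (\<lambda>\<omega>. g l (?X l \<omega>)) -` {0..} \<inter> space M)"
    unfolding recovery_prob_def
  proof (rule finite_measure_mono)
    show "recovery_event M n d pistar y y' \<subseteq> (\<Inter>l\<in>{..<?m}. (\<lambda>\<omega>. g l (?X l \<omega>)) -` {0..} \<inter> space M)"
      unfolding eq using recovery_subset_swap_fails by auto
    have "(\<lambda>\<omega>. g l (?X l \<omega>)) \<in> borel_measurable M" if "l < ?m" for l
      using ind that by (auto simp: indep_vars_def)
    then show "(\<Inter>l\<in>{..<?m}. (\<lambda>\<omega>. g l (?X l \<omega>)) -` {0..} \<inter> space M) \<in> events"
      using m by (intro sets.finite_INT measurable_sets) auto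
  qed
  also have "\<dots> = (\<Prod>l<?m. prob ((\<lambda>\<omega>. g l (?X l \<omega>)) -` {0..} \<inter> space M))"
    by (rule indep_varsD_finite[OF ind]) (use m in auto)
  also have "\<dots> \<le> (\<Prod>l<?m. p)"
    unfolding eq using p by (intro prod_mono) auto
  finally show ?thesis by simp
qed

lemma second_moment_pair_diff:
  assumes l: "l < n div 2"
  shows "k \<in> {1..d} \<Longrightarrow> integrable M (\<lambda>\<omega>. (pair_diff (l, 0, k) \<omega>)\<^sup>2)"
    "(\<Sum>k=1..d. expectation (\<lambda>\<omega>. (pair_diff (l, 0, k) \<omega>)\<^sup>2)) \<le> 2 * s"
proof -
  note diff = feature_difference_moment[OF pair_indices[OF l]]
  show "k \<in> {1..d} \<Longrightarrow> integrable M (\<lambda>\<omega>. (pair_diff (l, 0, k) \<omega>)\<^sup>2)"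
    unfolding pair_diff_simps by (rule diff(1))
  have "(\<Sum>k=1..d. expectation (\<lambda>\<omega>. (pair_diff (l, 0, k) \<omega>)\<^sup>2)) \<le> (\<Sum>k=1..d. 2 * s / d)"
    unfolding pair_diff_simps by (intro sum_mono diff(2))
  also have "\<dots> = 2 * s" using d_pos by simp
  finally show "(\<Sum>k=1..d. expectation (\<lambda>\<omega>. (pair_diff (l, 0, k) \<omega>)\<^sup>2)) \<le> 2 * s" .
qed

lemma recovery_prob_le:
  assumes "2 \<le> n"
  shows "recovery_prob M n d pistar y y' \<le>
    (1 / 2 + sqrt s / \<sigma> / 5 + 4 / 25 * (sqrt s / \<sigma>)\<^sup>2) ^ (n div 2)"
proof (rule recovery_prob_le_power[OF _ assms])
  fix l assume l: "l < n div 2"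
  \<comment> \<open>Taking differences multiplies the feature variance bound and the noise variance
    by 2 alike, so the ratio is unchanged.\<close>
  have w: "sqrt s / \<sigma> = sqrt (2 * s) / (sqrt 2 * \<sigma>)" by (simp add: real_sqrt_mult)
  show "prob (swap_fails l) \<le> 1 / 2 + sqrt s / \<sigma> / 5 + 4 / 25 * (sqrt s / \<sigma>)\<^sup>2"
    unfolding swap_fails_def
    by (rule prob_swap_fails_le[OF _ _ _ indep_single_pair_diff[OF l] normal_pair_diff[OF l]
        s_pos second_moment_pair_diff[OF l] w]) (use d_pos sigma_pos in auto)
qed

lemma recovery_prob_le_tail:
  assumes "2 \<le> n" and q: "8 * s * sqrt 128 \<le> \<sigma>\<^sup>2 * sqrt d * q"
  shows "recovery_prob M n d pistar y y' \<le> (1 - exp (- ((q + 1)\<^sup>2 / 2)) / 12) ^ (n div 2)"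
proof (rule recovery_prob_le_power[OF _ assms(1)])
  fix l assume l: "l < n div 2"
  \<comment> \<open>The noise differences have variance
    \<open>\<tau>\<^sup>2 = 2 * \<sigma>\<^sup>2\<close>, which turns the factor 8 into 16.\<close>
  have q': "16 * s * sqrt 128 \<le> (sqrt 2 * \<sigma>)\<^sup>2 * sqrt (card {1..d}) * q"
    using q by (simp add: power_mult_distrib mult_ac)
  show "prob (swap_fails l) \<le> 1 - exp (- ((q + 1)\<^sup>2 / 2)) / 12"
    unfolding swap_fails_def
    by (rule prob_swap_fails_le_tail[OF _ _ _ indep_single_pair_diff[OF l] normal_pair_diff[OF l]
        s_pos second_moment_pair_diff[OF l] q']) (use d_pos sigma_pos in auto)
qed

subsection \<open>Bounds on the recovery probability\<close>

text \<open>
  Applied with \<open>t = 1 + K/n\<close> and \<open>t = 1 - K/n\<close>. The constants in \<open>bound\<close> leave almost no room at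
  \<open>K = n/3\<close>, \<open>t = 4/3\<close>, which is why \<open>sqrt (2 * pi)\<close> is bounded by \<open>5/2\<close> and not by \<open>2\<close>.
\<close>

lemma recovery_prob_le_exp:
  assumes K: "4 < K" "K \<le> real n" and t: "0 < t"
    and \<sigma>: "2 * s * t powi (-2) \<le> \<sigma>\<^sup>2"
    and bound: "1 / 10 * (sqrt 2 * t) + 2 / 25 * t\<^sup>2 \<le> 1 / 2 - K / real n / 2"
  shows "recovery_prob M n d pistar y y' \<le> exp (- ((K - 4) / 4))"
proof -
  let ?w = "sqrt s / \<sigma>" and ?p = "1 / 2 + sqrt s / \<sigma> / 5 + 4 / 25 * (sqrt s / \<sigma>)\<^sup>2"
  have n: "2 \<le> n" "0 < real n" using K by linarith+
  have "2 * s \<le> (t * \<sigma>)\<^sup>2"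
    using \<sigma> t by (simp add: power_int_minus field_simps power_mult_distrib)
  then have "sqrt (2 * s) \<le> t * \<sigma>" using t sigma_pos by (intro real_le_lsqrt) auto
  then have "sqrt (2 * s) * sqrt 2 \<le> t * \<sigma> * sqrt 2" by (rule mult_right_mono) simp
  moreover have "sqrt (2 * s) * sqrt 2 = 2 * sqrt s" by (simp add: real_sqrt_mult)
  ultimately have "2 * sqrt s \<le> t * \<sigma> * sqrt 2" by (simp only:)
  then have w: "?w \<le> t * sqrt 2 / 2"
    using sigma_pos by (simp add: field_simps)
  have w0: "0 \<le> ?w" using s_pos sigma_pos by simp
  have "?w\<^sup>2 \<le> (t * sqrt 2 / 2)\<^sup>2" using w w0 by (rule power_mono)
  also have "\<dots> = t\<^sup>2 / 2" by (simp add: power_mult_distrib power_divide)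
  finally have "4 / 25 * ?w\<^sup>2 \<le> 2 / 25 * t\<^sup>2" by simp
  moreover have "?w / 5 \<le> 1 / 10 * (sqrt 2 * t)" using w by (simp add: mult.commute)
  ultimately have "?p \<le> 1 - K / real n / 2" using bound by linarith
  also have "\<dots> \<le> exp (- (K / real n / 2))" using exp_ge_add_one_self[of "- (K / real n / 2)"] by simp
  finally have p: "?p \<le> exp (- (K / real n / 2))" .
  have "recovery_prob M n d pistar y y' \<le> ?p ^ (n div 2)" by (rule recovery_prob_le[OF n(1)])
  also have "\<dots> \<le> exp (- (K / real n / 2)) ^ (n div 2)"
    using w0 by (intro power_mono p add_nonneg_nonneg) auto
  also have "\<dots> = exp (- (real (n div 2) * (K / real n / 2)))"
    by (simp add: exp_of_nat_mult[symmetric])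
  also have "\<dots> \<le> exp (- ((K - 4) / 4))"
  proof -
    \<comment> \<open>An odd \<open>n\<close> leaves one vertex unpaired. This costs at most
      \<open>K / n / 4 \<le> 1 / 4\<close> in the exponent, which the shift from \<open>K\<close> to
      \<open>K - 4\<close> absorbs.\<close>
    have "n \<le> 2 * (n div 2) + 1" by linarith
    then have "real n \<le> real (2 * (n div 2) + 1)" by (rule of_nat_mono)
    then have half: "(real n - 1) / 2 \<le> real (n div 2)" by simp
    have "K / real n \<le> 1" using K n by simp
    then have "(K - 4) / 4 \<le> (K - K / real n) / 4" by (intro divide_right_mono) linarith+
    also have "\<dots> = (real n - 1) / 2 * (K / real n / 2)" using n by (simp add: field_simps)
    also have "\<dots> \<le> real (n div 2) * (K / real n / 2)"
      using half K n by (intro mult_right_mono) auto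
    finally have "(K - 4) / 4 \<le> real (n div 2) * (K / real n / 2)" .
    then show ?thesis by (simp only: exp_le_cancel_iff neg_le_iff_le)
  qed
  finally show ?thesis .
qed

text \<open>With \<open>\<kappa> = K / n \<le> 1 / 3\<close> one has
  \<open>\<kappa>\<^sup>2 \<le> \<kappa> / 3\<close>, so the numerical condition becomes linear in
  \<open>\<kappa>\<close>.\<close>

lemma recovery_prob_le_exp_plus:
  assumes K: "4 < K" "3 * K \<le> real n" and \<sigma>: "2 * s * (1 + K / real n) powi (-2) \<le> \<sigma>\<^sup>2"
  shows "recovery_prob M n d pistar y y' \<le> exp (- ((K - 4) / 4))"
proof (rule recovery_prob_le_exp[OF K(1) _ _ \<sigma>])
  define \<kappa> where "\<kappa> = K / real n"
  have \<kappa>: "0 \<le> \<kappa>" "\<kappa> \<le> 1 / 3" using K by (auto simp: \<kappa>_def field_simps)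
  \<comment> \<open>The estimate \<open>sqrt 2 \<le> 3 / 2\<close> would be too weak at
    \<open>\<kappa> = 1 / 3\<close>.\<close>
  have sqrt2: "sqrt 2 \<le> 1415 / 1000" by (rule real_le_lsqrt) (simp_all add: power2_eq_square)
  define a where "a = sqrt 2 * (1 + \<kappa>)"
  have "a \<le> 1415 / 1000 * (1 + \<kappa>)"
    using sqrt2 \<kappa> unfolding a_def by (intro mult_right_mono) auto
  moreover have "\<kappa>\<^sup>2 \<le> 1 / 3 * \<kappa>" using \<kappa> unfolding power2_eq_square by (intro mult_right_mono) auto
  moreover have "(1 + \<kappa>)\<^sup>2 = 1 + 2 * \<kappa> + \<kappa>\<^sup>2" by (simp add: power2_sum)
  ultimately have "1 / 10 * a + 2 / 25 * (1 + \<kappa>)\<^sup>2 \<le> 1 / 2 - \<kappa> / 2" using \<kappa> by argo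
  then show "1 / 10 * (sqrt 2 * (1 + K / real n)) + 2 / 25 * (1 + K / real n)\<^sup>2 \<le> 1 / 2 - K / real n / 2"
    by (simp only: \<kappa>_def a_def)
  show "K \<le> real n" "0 < 1 + K / real n" using K by (auto simp: add_pos_nonneg)
qed

text \<open>For \<open>t = 1 - K / n\<close> the right side of the numerical condition is
  \<open>t / 2\<close>. Since \<open>t\<^sup>2 \<le> t\<close>, crude estimates suffice: the left
  side is at most \<open>0.28 * t\<close>.\<close>

lemma recovery_prob_le_exp_minus:
  assumes K: "4 < K" "K < real n" and \<sigma>: "2 * s * (1 - K / real n) powi (-2) \<le> \<sigma>\<^sup>2"
  shows "recovery_prob M n d pistar y y' \<le> exp (- ((K - 4) / 4))"
proof (rule recovery_prob_le_exp[OF K(1) _ _ \<sigma>])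
  define t where "t = 1 - K / real n"
  have t: "0 < t" "t \<le> 1" "1 / 2 - K / real n / 2 = t / 2" using K by (auto simp: t_def field_simps)
  have "sqrt 2 \<le> 2" by (rule real_le_lsqrt) (simp_all add: power2_eq_square)
  define a where "a = sqrt 2 * t"
  have "a \<le> 2 * t" using \<open>sqrt 2 \<le> 2\<close> t unfolding a_def by (intro mult_right_mono) auto
  moreover have "t\<^sup>2 \<le> 1 * t" using t unfolding power2_eq_square by (intro mult_right_mono) auto
  ultimately show "1 / 10 * (sqrt 2 * (1 - K / real n)) + 2 / 25 * (1 - K / real n)\<^sup>2 \<le> 1 / 2 - K / real n / 2"
    unfolding t_def[symmetric] a_def[symmetric] t(3) using t(1,2) by simp
  show "K \<le> real n" "0 < 1 - K / real n" using K t by (auto simp: t_def)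
qed

text \<open>The choice \<open>q' = sqrt (ln n) / 2\<close> gives
  \<open>(q' + 1)\<^sup>2 / 2 \<le> q'\<^sup>2 + 1 = ln n / 4 + 1\<close>. So each pair violates
  \<open>swap_fails\<close> with probability at least of order \<open>n powr (- 1 / 4)\<close>, far
  more than the order \<open>1 / n\<close> at which the number of pairs would cease to
  suffice.\<close>

lemma recovery_prob_le_subpolynomial:
  assumes n: "2 \<le> n" and q: "8 * s * sqrt 128 \<le> \<sigma>\<^sup>2 * sqrt d * (sqrt (ln n) / 2)"
  shows "recovery_prob M n d pistar y y' \<le> exp (- (real (n div 2) * (exp (- 1) * n powr (- 1 / 4) / 12)))"
proof -
  define q' where "q' = sqrt (ln n) / 2"
  have q'2: "q'\<^sup>2 = ln n / 4" using n by (simp add: q'_def power_divide)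
  let ?e = "exp (- 1) * n powr (- 1 / 4) / 12"
  have "(q' + 1)\<^sup>2 \<le> 2 * q'\<^sup>2 + 2" using zero_le_power2[of "q' - 1"] by (simp add: power2_sum power2_diff)
  then have "- 1 + (- 1 / 4) * ln n \<le> - ((q' + 1)\<^sup>2 / 2)" unfolding q'2 by simp
  then have "exp (- 1 + (- 1 / 4) * ln n) \<le> exp (- ((q' + 1)\<^sup>2 / 2))" by simp
  moreover have "exp (- 1 + (- 1 / 4) * ln n) = exp (- 1) * n powr (- 1 / 4)"
    using n by (simp only: exp_add powr_def) simp
  ultimately have "exp (- 1) * n powr (- 1 / 4) \<le> exp (- ((q' + 1)\<^sup>2 / 2))" by (simp only:)
  then have "1 - exp (- ((q' + 1)\<^sup>2 / 2)) / 12 \<le> 1 - ?e" by simp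
  also have "\<dots> \<le> exp (- ?e)" using exp_ge_add_one_self[of "- ?e"] by simp
  finally have e: "1 - exp (- ((q' + 1)\<^sup>2 / 2)) / 12 \<le> exp (- ?e)" .
  have e0: "0 \<le> 1 - exp (- ((q' + 1)\<^sup>2 / 2)) / 12"
    using order_trans[of "exp (- ((q' + 1)\<^sup>2 / 2))" 1 12] by simp
  have "recovery_prob M n d pistar y y' \<le> (1 - exp (- ((q' + 1)\<^sup>2 / 2)) / 12) ^ (n div 2)"
    by (rule recovery_prob_le_tail[OF n]) (use q in \<open>simp add: q'_def\<close>)
  also have "\<dots> \<le> exp (- ?e) ^ (n div 2)" by (rule power_mono[OF e e0])
  also have "\<dots> = exp (- (real (n div 2) * ?e))" by (simp add: exp_of_nat_mult[symmetric])
  finally show ?thesis .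
qed

end

section \<open>Limits as n tends to infinity\<close>

lemma recovery_prob_nonneg: "0 \<le> recovery_prob M n d pistar y y'"
  by (simp add: recovery_prob_def)

lemma recovery_prob_tendsto_0_strong_noise:
  fixes M :: "nat \<Rightarrow> 'a measure"
  assumes model: "\<forall>\<^sub>F n in sequentially.
      feature_model (M n) n (d n) (s n) (\<sigma> n) (pistar n) (x n) (\<epsilon> n) (\<epsilon>' n) (y n) (y' n)"
    and dom: "(\<lambda>n. (\<sigma> n)\<^sup>2) \<ggreater> s"
  shows "(\<lambda>n. recovery_prob (M n) n (d n) (pistar n) (y n) (y' n)) \<longlonglongrightarrow> 0"
proof (rule LIMSEQ_I)
  fix r :: real assume r: "0 < r"
  \<comment> \<open>\<open>K\<close> is fixed before \<open>n\<close>: the second entry makes the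
    bound at most \<open>r * exp (- 1 / 4)\<close>, and the first ensures \<open>4 < K\<close>. Once
    \<open>s n / (\<sigma> n)\<^sup>2 < 1 / 2\<close> and \<open>3 * K \<le> n\<close>, the finite
    bound applies.\<close>
  define K where "K = max 5 (5 - 4 * ln r)"
  have K: "4 < K" "exp (- ((K - 4) / 4)) < r"
  proof -
    have "5 - 4 * ln r \<le> K" by (simp add: K_def)
    then have "- ((K - 4) / 4) < ln r" by (simp add: field_simps)
    then have "exp (- ((K - 4) / 4)) < exp (ln r)" by (simp only: exp_less_cancel_iff)
    then show "exp (- ((K - 4) / 4)) < r" using r by simp
  qed (simp add: K_def)
  have "\<forall>\<^sub>F n in sequentially. s n / (\<sigma> n)\<^sup>2 < 1 / 2"
    using dom unfolding dominates_def by (rule order_tendstoD) simp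
  moreover have "\<forall>\<^sub>F n in sequentially. 3 * K \<le> real n"
    by real_asymp
  ultimately have "\<forall>\<^sub>F n in sequentially. norm (recovery_prob (M n) n (d n) (pistar n) (y n) (y' n) - 0) < r"
    using model
  proof eventually_elim
    case (elim n)
    interpret feature_model "M n" n "d n" "s n" "\<sigma> n" "pistar n" "x n" "\<epsilon> n" "\<epsilon>' n" "y n" "y' n"
      by (rule elim)
    have "1 \<le> 1 + K / real n" using K by simp
    then have "(1 + K / real n) powi (-2) \<le> 1"
      by (simp add: power_int_minus inverse_le_1_iff one_le_power)
    then have "2 * s n * (1 + K / real n) powi (-2) \<le> 2 * s n * 1"
      using s_pos by (intro mult_left_mono) auto
    also have "\<dots> \<le> (\<sigma> n)\<^sup>2" using elim sigma_pos by (simp add: field_simps)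
    finally have "recovery_prob (M n) n (d n) (pistar n) (y n) (y' n) \<le> exp (- ((K - 4) / 4))"
      by (rule recovery_prob_le_exp_plus[OF K(1) elim(2)])
    then show ?case using K(2) recovery_prob_nonneg[of "M n" n "d n" "pistar n" "y n" "y' n"] by simp
  qed
  then show "\<exists>no. \<forall>n\<ge>no. norm (recovery_prob (M n) n (d n) (pistar n) (y n) (y' n) - 0) < r"
    by (simp add: eventually_sequentially)
qed

lemma recovery_prob_tendsto_0_high_dimension:
  fixes M :: "nat \<Rightarrow> 'a measure"
  assumes model: "\<forall>\<^sub>F n in sequentially.
      feature_model (M n) n (d n) (s n) (\<sigma> n) (pistar n) (x n) (\<epsilon> n) (\<epsilon>' n) (y n) (y' n)"
    and dom: "(\<lambda>n. (\<sigma> n)\<^sup>2) \<ggreater> (\<lambda>n. s n / sqrt (real (d n) * ln (real n)))"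
  shows "(\<lambda>n. recovery_prob (M n) n (d n) (pistar n) (y n) (y' n)) \<longlonglongrightarrow> 0"
proof (rule tendsto_sandwich)
  show "\<forall>\<^sub>F n in sequentially. 0 \<le> recovery_prob (M n) n (d n) (pistar n) (y n) (y' n)"
    by (simp add: recovery_prob_nonneg)
  show "(\<lambda>n. 0) \<longlonglongrightarrow> (0::real)" by simp
  \<comment> \<open>The exponent is of order \<open>- (n powr (3 / 4))\<close>.\<close>
  show "(\<lambda>n. exp (- ((real n - 1) / 2 * (exp (- 1) * real n powr (- 1 / 4) / 12)))) \<longlonglongrightarrow> 0"
    by real_asymp
  \<comment> \<open>The constant is the one that makes the hypothesis of
    \<open>recovery_prob_le_subpolynomial\<close> hold; its factor 16 is 8 times the 2 from
    \<open>sqrt (ln n) / 2\<close>.\<close>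
  have "\<forall>\<^sub>F n in sequentially. s n / sqrt (real (d n) * ln (real n)) / (\<sigma> n)\<^sup>2 < 1 / (16 * sqrt 128)"
    using dom unfolding dominates_def by (rule order_tendstoD) simp
  with model eventually_ge_at_top[of 2]
  show "\<forall>\<^sub>F n in sequentially. recovery_prob (M n) n (d n) (pistar n) (y n) (y' n) \<le>
      exp (- ((real n - 1) / 2 * (exp (- 1) * real n powr (- 1 / 4) / 12)))"
  proof eventually_elim
    case (elim n)
    interpret feature_model "M n" n "d n" "s n" "\<sigma> n" "pistar n" "x n" "\<epsilon> n" "\<epsilon>' n" "y n" "y' n"
      by (rule elim)
    have pos: "0 < sqrt (real (d n)) * sqrt (ln (real n)) * (\<sigma> n)\<^sup>2"
      using d_pos sigma_pos elim(2) by simp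
    have "s n / (sqrt (real (d n)) * sqrt (ln (real n)) * (\<sigma> n)\<^sup>2) < 1 / (16 * sqrt 128)"
      using elim(3) by (simp add: real_sqrt_mult)
    then have "s n * (16 * sqrt 128) < sqrt (real (d n)) * sqrt (ln (real n)) * (\<sigma> n)\<^sup>2"
      using pos by (subst (asm) divide_less_eq) (auto simp: pos_less_divide_eq mult_ac)
    then have "8 * s n * sqrt 128 \<le> (\<sigma> n)\<^sup>2 * sqrt (d n) * (sqrt (ln n) / 2)"
      by (simp add: mult_ac)
    from recovery_prob_le_subpolynomial[OF elim(2) this]
    have "recovery_prob (M n) n (d n) (pistar n) (y n) (y' n)
        \<le> exp (- (real (n div 2) * (exp (- 1) * real n powr (- 1 / 4) / 12)))" .
    also have "\<dots> \<le> exp (- ((real n - 1) / 2 * (exp (- 1) * real n powr (- 1 / 4) / 12)))"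
    proof -
      have "n \<le> 2 * (n div 2) + 1" by linarith
      then have "real n \<le> real (2 * (n div 2) + 1)" by (rule of_nat_mono)
      then have "(real n - 1) / 2 \<le> real (n div 2)" by simp
      then show ?thesis by (subst exp_le_cancel_iff) (intro le_imp_neg_le mult_right_mono; simp)
    qed
    finally show ?case .
  qed
qed

text \<open>The finite bounds cap \<open>K\<close> in terms of \<open>n\<close>. With
  \<open>n\<close>, \<open>d\<close> and \<open>s\<close> fixed, an unbounded \<open>K\<close> in
  \<open>1 + K / n\<close> would admit \<sigma> near 0, where recovery can keep a positive
  probability while the claimed bound tends to 0. The form with \<open>1 - K / n\<close> covers all
  \<open>K\<close> between 4 and \<open>n\<close>.\<close>

theorem theorem3:
  shows
    "(\<forall>(M :: 'a measure) n d s \<sigma> pistar x \<epsilon> \<epsilon>' y y' (K :: real).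
        feature_model M n d s \<sigma> pistar x \<epsilon> \<epsilon>' y y' \<and> 4 < K \<and> 3 * K \<le> real n \<and>
        \<sigma>\<^sup>2 \<ge> 2 * s * (1 + K / real n) powi (-2)
        \<longrightarrow> recovery_prob M n d pistar y y' \<le> exp (- ((K - 4) / 4)))
   \<and> (\<forall>(M :: 'a measure) n d s \<sigma> pistar x \<epsilon> \<epsilon>' y y' (K :: real).
        feature_model M n d s \<sigma> pistar x \<epsilon> \<epsilon>' y y' \<and> 4 < K \<and> K < real n \<and>
        \<sigma>\<^sup>2 \<ge> 2 * s * (1 - K / real n) powi (-2)
        \<longrightarrow> recovery_prob M n d pistar y y' \<le> exp (- ((K - 4) / 4)))
   \<and> (\<forall>(M :: nat \<Rightarrow> 'a measure) d s \<sigma> pistar x \<epsilon> \<epsilon>' y y'.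
        (\<forall>\<^sub>F n in sequentially.
           feature_model (M n) n (d n) (s n) (\<sigma> n) (pistar n) (x n) (\<epsilon> n) (\<epsilon>' n) (y n) (y' n)) \<and>
        (\<lambda>n. (\<sigma> n)\<^sup>2) \<ggreater> s
        \<longrightarrow> (\<lambda>n. recovery_prob (M n) n (d n) (pistar n) (y n) (y' n)) \<longlonglongrightarrow> 0)
   \<and> (\<forall>(M :: nat \<Rightarrow> 'a measure) d s \<sigma> pistar x \<epsilon> \<epsilon>' y y'.
        (\<forall>\<^sub>F n in sequentially.
           feature_model (M n) n (d n) (s n) (\<sigma> n) (pistar n) (x n) (\<epsilon> n) (\<epsilon>' n) (y n) (y' n) \<and>
           (\<sigma> n)\<^sup>2 / 4 \<le> s n \<and> s n \<le> real (d n) / 2) \<and>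
        (\<lambda>n. (\<sigma> n)\<^sup>2) \<ggreater> (\<lambda>n. s n / sqrt (real (d n) * ln (real n)))
        \<longrightarrow> (\<lambda>n. recovery_prob (M n) n (d n) (pistar n) (y n) (y' n)) \<longlonglongrightarrow> 0)"
  apply (intro conjI allI impI; elim conjE)
  subgoal by (rule feature_model.recovery_prob_le_exp_plus)
  subgoal by (rule feature_model.recovery_prob_le_exp_minus)
  subgoal by (rule recovery_prob_tendsto_0_strong_noise)
  subgoal by (rule recovery_prob_tendsto_0_high_dimension) (auto elim: eventually_mono)
  done

end
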